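(* Let $G$ be a finite group acting on a finite set $\Omega$, and let $M\in\mathbb{C}(G,\Omega\times\Omega)$ be its incidence matrix, $M(g,(a,b))=1$ if $ga=b$ and $0$ otherwise. Let $\chi_0,\dots,\chi_n$ be the complex irreducible characters of $G$ and $V_0,\dots,V_n$ the corresponding eigenspaces of the conjugacy class association scheme of $G$. Let $I\subseteq\{0,\dots,n\}$ be the set of $k$ such that $\chi_k$ is an irreducible constituent of the permutation character $\xi$ of $G$ on $\Omega$. Then the column space of $M$ equals $\bigoplus_{k\in I}V_k$.
   Context: $\mathbb{C}(X,Y)$ denotes complex matrices with rows indexed by $X$ and columns by $Y$. The permutation character is $\xi(g)=|\{\omega\in\Omega: g\omega=\omega\}|$. For each irreducible character $\chi_k$, $E_k\in\mathbb{C}(G,G)$ is the matrix $E_k(x,y)=\frac{\chi_k(1)}{|G|}\chi_k(x^{-1}y)$ (the minimal idempotents of the conjugacy class association scheme), and $V_k$ is the column space of $E_k$ in $\mathbb{C}(G)=\mathbb{C}^G$. *)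

theory Defs
  imports
    "HOL-Algebra.Group_Action"
    "Jordan_Normal_Form.VS_Connect"
begin

section \<open>Complex characters of a finite group\<close>

text \<open>A matrix representation of degree \<open>d\<close> is a homomorphism into \<open>GL(d, \<complex>)\<close>, the group
  of units of the ring of complex \<open>d \<times> d\<close> matrices.\<close>

definition matrix_rep :: "('g, 'm) monoid_scheme \<Rightarrow> nat \<Rightarrow> ('g \<Rightarrow> complex mat) \<Rightarrow> bool" where
  "matrix_rep G d \<rho> \<longleftrightarrow> \<rho> \<in> hom G (units_of (ring_mat TYPE(complex) d ()))"

definition irreducible_rep :: "('g, 'm) monoid_scheme \<Rightarrow> nat \<Rightarrow> ('g \<Rightarrow> complex mat) \<Rightarrow> bool" where
  "irreducible_rep G d \<rho> \<longleftrightarrow>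
     matrix_rep G d \<rho> \<and> d > 0 \<and>
     (\<forall>W. subspace class_ring W (module_vec TYPE(complex) d) \<and>
          (\<forall>g \<in> carrier G. \<forall>w \<in> W. \<rho> g *\<^sub>v w \<in> W)
        \<longrightarrow> W = {0\<^sub>v d} \<or> W = carrier_vec d)"

text \<open>Class functions, and characters in particular, are extensional on \<open>carrier G\<close>, so that
  two characters are equal as functions iff they agree on \<open>G\<close>.\<close>

definition rep_character ::
    "('g, 'm) monoid_scheme \<Rightarrow> nat \<Rightarrow> ('g \<Rightarrow> complex mat) \<Rightarrow> 'g \<Rightarrow> complex" where
  "rep_character G d \<rho> = (\<lambda>g \<in> carrier G. \<Sum>i<d. \<rho> g $$ (i, i))"

definition irr_characters :: "('g, 'm) monoid_scheme \<Rightarrow> ('g \<Rightarrow> complex) set" where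
  "irr_characters G = {rep_character G d \<rho> | d \<rho>. irreducible_rep G d \<rho>}"

text \<open>\<open>\<chi>\<close> is an irreducible constituent of \<open>\<theta>\<close> if it occurs with positive multiplicity in a
  decomposition of \<open>\<theta>\<close> as a sum of irreducible characters.\<close>

definition irr_constituent ::
    "('g, 'm) monoid_scheme \<Rightarrow> ('g \<Rightarrow> complex) \<Rightarrow> ('g \<Rightarrow> complex) \<Rightarrow> bool" where
  "irr_constituent G \<chi> \<theta> \<longleftrightarrow>
     \<chi> \<in> irr_characters G \<and>
     (\<exists>m :: ('g \<Rightarrow> complex) \<Rightarrow> nat. m \<chi> > 0 \<and>
        (\<forall>g \<in> carrier G. \<theta> g = (\<Sum>\<psi> \<in> irr_characters G. of_nat (m \<psi>) * \<psi> g)))"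

definition perm_character ::
    "('g, 'm) monoid_scheme \<Rightarrow> 'o set \<Rightarrow> ('g \<Rightarrow> 'o \<Rightarrow> 'o) \<Rightarrow> 'g \<Rightarrow> complex" where
  "perm_character G \<Omega> \<phi> = (\<lambda>g \<in> carrier G. of_nat (card (invariants \<Omega> \<phi> g)))"


section \<open>Matrices with rows and columns indexed by sets\<close>

text \<open>A matrix in \<open>\<complex>(X, Y)\<close> is given by its entries \<open>A x y\<close> for \<open>x \<in> X\<close> and \<open>y \<in> Y\<close>, and
  \<open>\<complex>(X)\<close> is the space of functions \<open>X \<rightarrow> \<complex>\<close> (extensional outside \<open>X\<close>).\<close>

abbreviation complex_fun_space :: "'x set \<Rightarrow> (complex, 'x \<Rightarrow> complex) module" where
  "complex_fun_space X \<equiv> LinearCombinations.ring.func_space class_ring X"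

definition column_space :: "'x set \<Rightarrow> 'y set \<Rightarrow> ('x \<Rightarrow> 'y \<Rightarrow> complex) \<Rightarrow> ('x \<Rightarrow> complex) set" where
  "column_space X Y A =
     LinearCombinations.module.span class_ring (complex_fun_space X)
       ((\<lambda>y. \<lambda>x \<in> X. A x y) ` Y)"

definition incidence_matrix :: "('g \<Rightarrow> 'o \<Rightarrow> 'o) \<Rightarrow> 'g \<Rightarrow> 'o \<times> 'o \<Rightarrow> complex" where
  "incidence_matrix \<phi> g = (\<lambda>(a, b). if \<phi> g a = b then 1 else 0)"

definition scheme_idempotent ::
    "('g, 'm) monoid_scheme \<Rightarrow> ('g \<Rightarrow> complex) \<Rightarrow> 'g \<Rightarrow> 'g \<Rightarrow> complex" where
  "scheme_idempotent G \<chi> x y =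
     \<chi> \<one>\<^bsub>G\<^esub> / of_nat (card (carrier G)) * \<chi> (inv\<^bsub>G\<^esub> x \<otimes>\<^bsub>G\<^esub> y)"

definition scheme_eigenspace ::
    "('g, 'm) monoid_scheme \<Rightarrow> ('g \<Rightarrow> complex) \<Rightarrow> ('g \<Rightarrow> complex) set" where
  "scheme_eigenspace G \<chi> = column_space (carrier G) (carrier G) (scheme_idempotent G \<chi>)"


section \<open>Internal direct sums\<close>

text \<open>\<open>W\<close> is the internal direct sum of the subspaces \<open>U k\<close> of \<open>V\<close>, \<open>k \<in> I\<close>: each element of
  \<open>W\<close> is \<open>\<Sum>k\<in>I. u k\<close> for exactly one family of \<open>u k \<in> U k\<close>, and all these sums lie in \<open>W\<close>.\<close>

definition is_direct_sum ::
    "('a, 'r) ring_scheme \<Rightarrow> ('a, 'v, 's) module_scheme \<Rightarrow> 'i set \<Rightarrow> ('i \<Rightarrow> 'v set) \<Rightarrow> 'v set \<Rightarrow> bool"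
  where
  "is_direct_sum K V I U W \<longleftrightarrow>
     finite I \<and> (\<forall>k \<in> I. subspace K (U k) V) \<and>
     bij_betw (\<lambda>u. \<Oplus>\<^bsub>V\<^esub>k \<in> I. u k) (\<Pi>\<^sub>E k \<in> I. U k) W"

end

theory Submission
  imports Defs "Jordan_Normal_Form.DL_Rank" "Jordan_Normal_Form.Spectral_Radius"
begin

text \<open>Let \<open>P\<^sub>\<chi>\<close> be the operator with matrix \<open>E\<^sub>\<chi>\<close>. Schur orthogonality makes the \<open>P\<^sub>\<chi>\<close>
  mutually orthogonal idempotents, and the decomposition of the regular character shows that they
  sum to the identity; hence the \<open>V\<^sub>\<chi>\<close> are independent and every \<open>f\<close> is the sum of its
  projections. Let \<open>\<xi> = \<Sum> m\<^sub>\<chi> \<chi>\<close>, so that convolving \<open>\<chi>\<close> with \<open>\<xi>\<close> multiplies it by a nonzero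
  multiple of \<open>m\<^sub>\<chi>\<close>. Since \<open>\<xi> (y\<^sup>-\<^sup>1 z)\<close> counts the \<open>a\<close> with \<open>y a = z a\<close>, for \<open>m\<^sub>\<chi> > 0\<close> this
  convolution writes the columns of \<open>E\<^sub>\<chi>\<close> in terms of columns of \<open>M\<close>. For \<open>m\<^sub>\<chi> = 0\<close> it vanishes,
  and its inner product with \<open>\<chi>\<close> is the sum of the squared moduli of the pairings of \<open>\<chi>\<close> with the
  columns of \<open>M\<close>, so \<open>P\<^sub>\<chi>\<close> kills the column space of \<open>M\<close>.\<close>

section \<open>Schur orthogonality\<close>

lemma subspace_vec_iff:
  "VectorSpace.subspace class_ring W (module_vec TYPE('a::field) d) \<longleftrightarrow>
     W \<subseteq> carrier_vec d \<and> 0\<^sub>v d \<in> W \<and> (\<forall>v\<in>W. \<forall>w\<in>W. v + w \<in> W) \<and> (\<forall>c. \<forall>v\<in>W. c \<cdot>\<^sub>v v \<in> W)"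
  using vec_vs[of d, where ?'a = 'a] vec_module[of d, where ?'a = 'a]
  by (auto simp: VectorSpace.subspace_def submodule_def module_vec_simps)

text \<open>Cyclicity of the trace. The factors may be rectangular, because
  \<open>intertwiner_zero\<close> applies it while the degrees \<open>d\<close> and \<open>e\<close>
  are not known to agree.\<close>

lemma sum_diag_mult_commute:
  fixes A B :: "'a::comm_semiring_0 mat"
  assumes "A \<in> carrier_mat n m" "B \<in> carrier_mat m n"
  shows "(\<Sum>i<n. (A * B) $$ (i, i)) = (\<Sum>i<m. (B * A) $$ (i, i))"
proof -
  have "(\<Sum>i<n. (A * B) $$ (i, i)) = (\<Sum>i<n. \<Sum>j<m. A $$ (i, j) * B $$ (j, i))"
    using assms by (intro sum.cong) (auto simp: scalar_prod_def atLeast0LessThan)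
  also have "\<dots> = (\<Sum>j<m. \<Sum>i<n. B $$ (j, i) * A $$ (i, j))"
    by (subst sum.swap) (simp add: mult.commute)
  also have "\<dots> = (\<Sum>i<m. (B * A) $$ (i, i))"
    using assms by (intro sum.cong) (auto simp: scalar_prod_def atLeast0LessThan)
  finally show ?thesis .
qed

lemma mult_mat_entry:
  fixes A B :: "'a::semiring_0 mat"
  assumes "A \<in> carrier_mat n m" "B \<in> carrier_mat m p" "i < n" "j < p"
  shows "(A * B) $$ (i, j) = (\<Sum>k<m. A $$ (i, k) * B $$ (k, j))"
  using assms by (auto simp: scalar_prod_def atLeast0LessThan)

lemma mult_mat_unit_vec_entry:
  fixes A :: "'a::semiring_1 mat"
  assumes "A \<in> carrier_mat n m" "i < n" "j < m"
  shows "(A *\<^sub>v unit_vec m j) $ i = A $$ (i, j)"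
  using assms by auto

locale finite_group = group G for G :: "('g, 'm) monoid_scheme" (structure) +
  assumes finite_carrier: "finite (carrier G)"
begin

text \<open>\<open>\<rho> (inv g)\<close> supplies the inverse of \<open>\<rho> g\<close>, so the
  premises already make every \<open>\<rho> g\<close> a unit of the matrix ring.\<close>

lemma matrix_repI:
  assumes "\<And>g. g \<in> carrier G \<Longrightarrow> \<rho> g \<in> carrier_mat d d"
    and "\<And>g h. g \<in> carrier G \<Longrightarrow> h \<in> carrier G \<Longrightarrow> \<rho> (g \<otimes> h) = \<rho> g * \<rho> h"
    and "\<rho> \<one> = 1\<^sub>m d"
  shows "matrix_rep G d \<rho>"
proof -
  have "\<rho> g \<in> Units (ring_mat TYPE(complex) d ())" if "g \<in> carrier G" for g
    using that assms(1)[of g] assms(1)[of "inv g"] assms(2)[of g "inv g"] assms(2)[of "inv g" g] assms(3)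
    by (auto simp: Units_def ring_mat_simps)
  then show ?thesis
    using assms(2) by (auto simp: matrix_rep_def hom_def units_of_def ring_mat_simps)
qed

lemma matrix_repD:
  assumes "matrix_rep G d \<rho>"
  shows "\<And>g. g \<in> carrier G \<Longrightarrow> \<rho> g \<in> carrier_mat d d"
    and "\<And>g h. g \<in> carrier G \<Longrightarrow> h \<in> carrier G \<Longrightarrow> \<rho> (g \<otimes> h) = \<rho> g * \<rho> h"
    and "\<rho> \<one> = 1\<^sub>m d"
proof -
  let ?R = "ring_mat TYPE(complex) d ()"
  have h: "\<rho> \<in> hom G (units_of ?R)" using assms by (simp add: matrix_rep_def)
  show c: "\<And>g. g \<in> carrier G \<Longrightarrow> \<rho> g \<in> carrier_mat d d"
    using h by (auto simp: hom_def units_of_def Units_def ring_mat_simps Pi_iff)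
  show "\<And>g h. g \<in> carrier G \<Longrightarrow> h \<in> carrier G \<Longrightarrow> \<rho> (g \<otimes> h) = \<rho> g * \<rho> h"
    using h by (auto simp: hom_def units_of_def ring_mat_simps)
  interpret R: semiring ?R by (rule semiring_mat)
  have "group (units_of ?R)" by (rule R.units_group)
  then have "\<rho> \<one> = \<one>\<^bsub>units_of ?R\<^esub>"
    using h group.is_group by (intro hom_one) auto
  then show "\<rho> \<one> = 1\<^sub>m d" by (simp add: units_of_def ring_mat_simps)
qed

section \<open>Intertwining operators between irreducible representations\<close>

text \<open>Schur's lemma: the kernel \<open>K\<close> and the image \<open>J\<close> of
  \<open>T\<close> are invariant subspaces, hence zero or everything. Every combination other than
  zero kernel and full image forces \<open>T\<close> to be zero.\<close>

lemma intertwiner_cases: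
  assumes \<rho>: "irreducible_rep G d \<rho>" and \<sigma>: "irreducible_rep G e \<sigma>"
    and T: "T \<in> carrier_mat e d"
    and eq: "\<And>g. g \<in> carrier G \<Longrightarrow> \<sigma> g * T = T * \<rho> g"
  shows "T = 0\<^sub>m e d \<or> (\<forall>v\<in>carrier_vec d. T *\<^sub>v v = 0\<^sub>v e \<longrightarrow> v = 0\<^sub>v d) \<and>
    (\<forall>w\<in>carrier_vec e. \<exists>v\<in>carrier_vec d. T *\<^sub>v v = w)"
proof -
  note r = matrix_repD[of d \<rho>] and s = matrix_repD[of e \<sigma>]
  have mr: "matrix_rep G d \<rho>" "matrix_rep G e \<sigma>" using \<rho> \<sigma> by (auto simp: irreducible_rep_def)
  have eqv: "\<sigma> g *\<^sub>v (T *\<^sub>v v) = T *\<^sub>v (\<rho> g *\<^sub>v v)" if "g \<in> carrier G" "v \<in> carrier_vec d" for g v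
    using eq[OF that(1)] assoc_mult_mat_vec[OF s(1)[OF mr(2) that(1)] T that(2)]
      assoc_mult_mat_vec[OF T r(1)[OF mr(1) that(1)] that(2)] by simp
  define K where "K = {v \<in> carrier_vec d. T *\<^sub>v v = 0\<^sub>v e}"
  define J where "J = (\<lambda>v. T *\<^sub>v v) ` carrier_vec d"
  have T0: "T *\<^sub>v 0\<^sub>v d = 0\<^sub>v e" using T by auto
  have K: "K = {0\<^sub>v d} \<or> K = carrier_vec d"
  proof -
    have "VectorSpace.subspace class_ring K (module_vec TYPE(complex) d)"
      unfolding subspace_vec_iff K_def using T T0
      by (auto simp: mult_add_distrib_mat_vec mult_mat_vec)
    moreover have "\<rho> g *\<^sub>v w \<in> K" if "g \<in> carrier G" "w \<in> K" for g w
    proof -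
      have "T *\<^sub>v (\<rho> g *\<^sub>v w) = \<sigma> g *\<^sub>v 0\<^sub>v e"
        using that eqv[of g w] by (auto simp: K_def)
      also have "\<dots> = 0\<^sub>v e" using s(1)[OF mr(2) that(1)] by auto
      finally show ?thesis using that r(1)[OF mr(1) that(1)] by (auto simp: K_def)
    qed
    ultimately show ?thesis using \<rho> by (auto simp: irreducible_rep_def)
  qed
  have J: "J = {0\<^sub>v e} \<or> J = carrier_vec e"
  proof -
    have "VectorSpace.subspace class_ring J (module_vec TYPE(complex) e)"
      unfolding subspace_vec_iff
    proof (intro conjI ballI allI)
      show "J \<subseteq> carrier_vec e" using T by (auto simp: J_def)
      show "0\<^sub>v e \<in> J" using T0 by (auto simp: J_def intro!: image_eqI[of _ _ "0\<^sub>v d"])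
      show "v + w \<in> J" if "v \<in> J" "w \<in> J" for v w
        using that T by (auto simp: J_def mult_add_distrib_mat_vec[symmetric])
      show "c \<cdot>\<^sub>v v \<in> J" if "v \<in> J" for c v
        using that T by (auto simp: J_def mult_mat_vec[symmetric])
    qed
    moreover have "\<sigma> g *\<^sub>v w \<in> J" if "g \<in> carrier G" "w \<in> J" for g w
      using that eqv r(1)[OF mr(1)] by (fastforce simp: J_def)
    ultimately show ?thesis using \<sigma> by (auto simp: irreducible_rep_def)
  qed
  have "T = 0\<^sub>m e d" if *: "\<forall>v\<in>carrier_vec d. T *\<^sub>v v = 0\<^sub>v e"
  proof (rule eq_matI)
    fix i j assume ij: "i < dim_row (0\<^sub>m e d :: complex mat)" "j < dim_col (0\<^sub>m e d :: complex mat)"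
    have "(T *\<^sub>v unit_vec d j) $ i = 0" using * ij by auto
    then show "T $$ (i, j) = 0\<^sub>m e d $$ (i, j)" using T ij by auto
  qed (use T in auto)
  moreover have "\<forall>v\<in>carrier_vec d. T *\<^sub>v v = 0\<^sub>v e" if "K = carrier_vec d \<or> J = {0\<^sub>v e}"
    using that by (auto simp: K_def J_def)
  moreover have "(\<forall>v\<in>carrier_vec d. T *\<^sub>v v = 0\<^sub>v e \<longrightarrow> v = 0\<^sub>v d) \<and>
    (\<forall>w\<in>carrier_vec e. \<exists>v\<in>carrier_vec d. T *\<^sub>v v = w)" if "K = {0\<^sub>v d}" "J = carrier_vec e"
  proof (intro conjI ballI impI)
    show "v = 0\<^sub>v d" if "v \<in> carrier_vec d" "T *\<^sub>v v = 0\<^sub>v e" for v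
      using that \<open>K = {0\<^sub>v d}\<close> unfolding K_def by blast
    show "\<exists>v\<in>carrier_vec d. T *\<^sub>v v = w" if "w \<in> carrier_vec e" for w
    proof -
      have "w \<in> J" using that \<open>J = carrier_vec e\<close> by simp
      then show ?thesis by (auto simp: J_def)
    qed
  qed
  ultimately show ?thesis using K J by metis
qed

text \<open>A nonzero intertwiner is bijective, so it has an inverse \<open>S\<close>, and
  \<open>\<rho> g = S * (\<sigma> g * T)\<close>. Taking traces identifies the two
  characters.\<close>

lemma intertwiner_zero:
  assumes \<rho>: "irreducible_rep G d \<rho>" and \<sigma>: "irreducible_rep G e \<sigma>"
    and T: "T \<in> carrier_mat e d"
    and eq: "\<And>g. g \<in> carrier G \<Longrightarrow> \<sigma> g * T = T * \<rho> g"
    and ne: "rep_character G d \<rho> \<noteq> rep_character G e \<sigma>"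
  shows "T = 0\<^sub>m e d"
proof (rule ccontr)
  assume "T \<noteq> 0\<^sub>m e d"
  then have inj: "\<And>v. v \<in> carrier_vec d \<Longrightarrow> T *\<^sub>v v = 0\<^sub>v e \<Longrightarrow> v = 0\<^sub>v d"
    and surj: "\<And>w. w \<in> carrier_vec e \<Longrightarrow> \<exists>v\<in>carrier_vec d. T *\<^sub>v v = w"
    using intertwiner_cases[OF \<rho> \<sigma> T eq] by auto
  have mr: "matrix_rep G d \<rho>" "matrix_rep G e \<sigma>" using \<rho> \<sigma> by (auto simp: irreducible_rep_def)
  \<comment> \<open>\<open>s j\<close> is a preimage of the \<open>j\<close>-th unit vector; with
    these as columns, \<open>S\<close> is a right inverse of \<open>T\<close> by
    construction.\<close>
  obtain s where s: "\<And>j. s j \<in> carrier_vec d" "\<And>j. T *\<^sub>v s j = unit_vec e j"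
    using surj[OF unit_vec_carrier] by metis
  define S where "S = mat_of_cols d (map s [0..<e])"
  have S: "S \<in> carrier_mat d e" by (auto simp: S_def)
  have colS: "col S j = s j" if "j < e" for j using that s by (auto simp: S_def)
  have TS: "T * S = 1\<^sub>m e"
  proof (rule eq_matI)
    fix i j assume ij: "i < dim_row (1\<^sub>m e :: complex mat)" "j < dim_col (1\<^sub>m e :: complex mat)"
    have "(T * S) $$ (i, j) = (T *\<^sub>v s j) $ i" using ij T S colS by auto
    then show "(T * S) $$ (i, j) = 1\<^sub>m e $$ (i, j)" using s ij by auto
  qed (use T S in auto)
  \<comment> \<open>The left inverse comes from injectivity: \<open>T\<close> maps a unit vector
    \<open>?u\<close> and its image \<open>w\<close> under \<open>S * T\<close> to the same
    vector.\<close>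
  have ST: "S * T = 1\<^sub>m d"
  proof (rule eq_matI)
    fix i j assume ij: "i < dim_row (1\<^sub>m d :: complex mat)" "j < dim_col (1\<^sub>m d :: complex mat)"
    let ?u = "unit_vec d j :: complex vec"
    define w where "w = S *\<^sub>v (T *\<^sub>v ?u)"
    have w: "w \<in> carrier_vec d" using S unfolding w_def carrier_vec_def by simp
    have "T *\<^sub>v w = (T * S) *\<^sub>v (T *\<^sub>v ?u)"
      unfolding w_def using T S by (intro assoc_mult_mat_vec[symmetric]) auto
    also have "\<dots> = T *\<^sub>v ?u" using TS T by auto
    finally have "T *\<^sub>v (w - ?u) = 0\<^sub>v e"
      using T w by (subst mult_minus_distrib_mat_vec) auto
    then have "w - ?u = 0\<^sub>v d" using w by (intro inj) auto
    then have "(w - ?u) $ i = 0\<^sub>v d $ i" by (rule arg_cong)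
    then have "w $ i = ?u $ i" using w ij by (simp del: index_unit_vec(1))
    then have "(S *\<^sub>v (T *\<^sub>v ?u)) $ i = ?u $ i" by (simp add: w_def)
    then have "((S * T) *\<^sub>v ?u) $ i = ?u $ i"
      by (simp only: assoc_mult_mat_vec[OF S T unit_vec_carrier])
    then show "(S * T) $$ (i, j) = 1\<^sub>m d $$ (i, j)"
      using mult_mat_unit_vec_entry[of "S * T" d d i j] S T ij by simp
  qed (use T S in auto)
  have "rep_character G d \<rho> g = rep_character G e \<sigma> g" for g
  proof (cases "g \<in> carrier G")
    case g: True
    have c: "\<rho> g \<in> carrier_mat d d" "\<sigma> g \<in> carrier_mat e e" using mr matrix_repD(1) g by auto
    have "S * (\<sigma> g * T) = \<rho> g"
      using assoc_mult_mat[OF S T c(1)] ST left_mult_one_mat[OF c(1)] by (simp add: eq[OF g])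
    then have "(\<Sum>i<d. \<rho> g $$ (i, i)) = (\<Sum>i<d. (S * (\<sigma> g * T)) $$ (i, i))" by simp
    also have "\<dots> = (\<Sum>i<e. ((\<sigma> g * T) * S) $$ (i, i))"
      using S T c by (intro sum_diag_mult_commute) auto
    also have "(\<sigma> g * T) * S = \<sigma> g" using S T c TS by (simp add: assoc_mult_mat)
    finally show ?thesis using g by (simp add: rep_character_def)
  qed (simp add: rep_character_def)
  then show False using ne by auto
qed

text \<open>Over the complex numbers \<open>T\<close> has an eigenvalue \<open>c\<close>, since
  \<open>d > 0\<close>. Then \<open>U\<close>, which is \<open>T\<close> minus \<open>c\<close>
  times the identity, is an intertwiner killing an eigenvector. This excludes the bijective
  alternative of \<open>intertwiner_cases\<close>, so \<open>U\<close> is zero.\<close>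

lemma intertwiner_scalar:
  assumes \<rho>: "irreducible_rep G d \<rho>" and T: "T \<in> carrier_mat d d"
    and eq: "\<And>g. g \<in> carrier G \<Longrightarrow> \<rho> g * T = T * \<rho> g"
  shows "\<exists>c. T = c \<cdot>\<^sub>m 1\<^sub>m d"
proof -
  have mr: "matrix_rep G d \<rho>" and d: "d > 0" using \<rho> by (auto simp: irreducible_rep_def)
  obtain c where "c \<in> spectrum T" using spectrum_non_empty[OF T d] by auto
  then obtain v where v: "v \<in> carrier_vec d" "v \<noteq> 0\<^sub>v d" "T *\<^sub>v v = c \<cdot>\<^sub>v v"
    using T by (auto simp: spectrum_def eigenvalue_def eigenvector_def)
  define U where "U = T - c \<cdot>\<^sub>m 1\<^sub>m d"
  have U: "U \<in> carrier_mat d d" using T by (auto simp: U_def)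
  have "\<rho> g * U = U * \<rho> g" if g: "g \<in> carrier G" for g
  proof -
    have c: "\<rho> g \<in> carrier_mat d d" using mr matrix_repD(1) g by auto
    have "\<rho> g * (c \<cdot>\<^sub>m 1\<^sub>m d) = c \<cdot>\<^sub>m \<rho> g" "(c \<cdot>\<^sub>m 1\<^sub>m d) * \<rho> g = c \<cdot>\<^sub>m \<rho> g"
      using c by (auto simp: mult_smult_distrib)
    then show ?thesis using eq[OF g] c T unfolding U_def
      by (subst mult_minus_distrib_mat minus_mult_distrib_mat; auto)+
  qed
  moreover have "U *\<^sub>v v = 0\<^sub>v d"
  proof -
    have "U *\<^sub>v v = T *\<^sub>v v - (c \<cdot>\<^sub>m 1\<^sub>m d) *\<^sub>v v"
      using T v unfolding U_def by (intro minus_mult_distrib_mat_vec) auto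
    also have "(c \<cdot>\<^sub>m 1\<^sub>m d) *\<^sub>v v = c \<cdot>\<^sub>v v" using v
      by (auto intro!: eq_vecI simp: scalar_prod_def one_mat_def sum.remove if_distrib sum.delta cong: if_cong)
    finally show ?thesis using v by auto
  qed
  ultimately have "U = 0\<^sub>m d d" using intertwiner_cases[OF \<rho> \<rho> U] v by auto
  have "T $$ (i, j) = (c \<cdot>\<^sub>m 1\<^sub>m d) $$ (i, j)" if "i < d" "j < d" for i j
  proof -
    have "T $$ (i, j) - (c \<cdot>\<^sub>m 1\<^sub>m d) $$ (i, j) = U $$ (i, j)"
      using that T by (simp add: U_def)
    then show ?thesis using that \<open>U = 0\<^sub>m d d\<close> by simp
  qed
  then have "T = c \<cdot>\<^sub>m 1\<^sub>m d"
    using T by (intro eq_matI) auto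
  then show ?thesis by blast
qed

section \<open>Averaging over the group and orthogonality of matrix entries\<close>

lemma sum_left_translate:
  assumes "g \<in> carrier G"
  shows "(\<Sum>y\<in>carrier G. f (g \<otimes> y)) = (\<Sum>y\<in>carrier G. f y)"
  using assms
  by (intro sum.reindex_bij_witness[of _ "\<lambda>y. inv g \<otimes> y" "\<lambda>y. g \<otimes> y"])
     (auto simp: m_assoc[symmetric])

text \<open>\<open>T\<close> is the sum of \<open>\<sigma> y * X * \<rho> (inv y)\<close> over the
  group, for the matrix unit \<open>X\<close> with its 1 in position \<open>(j, k)\<close>.
  Translating the summation index by \<open>g\<close> shows that it intertwines.\<close>

lemma averaged_intertwiner:
  assumes \<rho>: "matrix_rep G d \<rho>" and \<sigma>: "matrix_rep G e \<sigma>" and "j < e" "k < d" and g: "g \<in> carrier G"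
  defines "T \<equiv> mat e d (\<lambda>(i, l). \<Sum>y\<in>carrier G. \<sigma> y $$ (i, j) * \<rho> (inv y) $$ (k, l))"
  shows "\<sigma> g * T = T * \<rho> g"
proof (rule eq_matI)
  note r = matrix_repD[OF \<rho>] and s = matrix_repD[OF \<sigma>]
  have T: "T \<in> carrier_mat e d" by (simp add: T_def)
  fix i l assume "i < dim_row (T * \<rho> g)" "l < dim_col (T * \<rho> g)"
  then have il: "i < e" "l < d" using T r(1)[OF g] by auto
  have "(\<sigma> g * T) $$ (i, l) =
      (\<Sum>p<e. \<Sum>y\<in>carrier G. \<sigma> g $$ (i, p) * (\<sigma> y $$ (p, j) * \<rho> (inv y) $$ (k, l)))"
    unfolding mult_mat_entry[OF s(1)[OF g] T il] using il by (simp add: T_def sum_distrib_left)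
  also have "\<dots> = (\<Sum>y\<in>carrier G. \<sigma> (g \<otimes> y) $$ (i, j) * \<rho> (inv y) $$ (k, l))"
    using assms il by (subst sum.swap)
      (simp add: s(2) mult_mat_entry[OF s(1) s(1)] sum_distrib_right mult.assoc)
  \<comment> \<open>Since \<open>inv y = inv (g \<otimes> y) \<otimes> g\<close>, the summand is a
    function of \<open>g \<otimes> y\<close> alone, and left translation applies.\<close>
  also have "\<dots> = (\<Sum>y\<in>carrier G. \<sigma> (g \<otimes> y) $$ (i, j) * \<rho> (inv (g \<otimes> y) \<otimes> g) $$ (k, l))"
    using g by (intro sum.cong) (auto simp: inv_mult_group m_assoc)
  also have "\<dots> = (\<Sum>y\<in>carrier G. \<sigma> y $$ (i, j) * \<rho> (inv y \<otimes> g) $$ (k, l))"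
    by (rule sum_left_translate[OF g, of "\<lambda>y. \<sigma> y $$ (i, j) * \<rho> (inv y \<otimes> g) $$ (k, l)"])
  also have "\<dots> = (\<Sum>p<d. \<Sum>y\<in>carrier G. \<sigma> y $$ (i, j) * \<rho> (inv y) $$ (k, p) * \<rho> g $$ (p, l))"
    using assms il by (subst sum.swap)
      (simp add: r(2) mult_mat_entry[OF r(1) r(1)] sum_distrib_left mult.assoc)
  also have "\<dots> = (T * \<rho> g) $$ (i, l)"
    unfolding mult_mat_entry[OF T r(1)[OF g] il] using il by (simp add: T_def sum_distrib_right)
  finally show "(\<sigma> g * T) $$ (i, l) = (T * \<rho> g) $$ (i, l)" .
qed (use matrix_repD(1)[OF \<rho> g] matrix_repD(1)[OF \<sigma> g] in \<open>auto simp: T_def\<close>)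

text \<open>The sum is the \<open>(i, l)\<close> entry of an averaged intertwiner from
  \<open>\<rho>\<close> to \<open>\<sigma>\<close>, which vanishes as the characters differ.\<close>

lemma schur_orthogonality_distinct:
  assumes \<rho>: "irreducible_rep G d \<rho>" and \<sigma>: "irreducible_rep G e \<sigma>"
    and ne: "rep_character G d \<rho> \<noteq> rep_character G e \<sigma>"
    and "i < e" "j < e" "k < d" "l < d"
  shows "(\<Sum>y\<in>carrier G. \<sigma> y $$ (i, j) * \<rho> (inv y) $$ (k, l)) = 0"
proof -
  define T where "T = mat e d (\<lambda>(i, l). \<Sum>y\<in>carrier G. \<sigma> y $$ (i, j) * \<rho> (inv y) $$ (k, l))"
  have "T = 0\<^sub>m e d"
    using assms unfolding T_def
    by (intro intertwiner_zero[OF \<rho> \<sigma>] averaged_intertwiner) (auto simp: irreducible_rep_def)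
  then have "T $$ (i, l) = 0" using assms by simp
  then show ?thesis using assms by (simp add: T_def)
qed

text \<open>The averaged intertwiner is \<open>c\<close> times the identity. Its trace is therefore
  \<open>d * c\<close>; computed from the definition, the trace is |G| if \<open>j = k\<close> and 0
  otherwise.\<close>

lemma schur_orthogonality_same:
  assumes \<rho>: "irreducible_rep G d \<rho>" and ijkl: "i < d" "j < d" "k < d" "l < d"
  shows "(\<Sum>y\<in>carrier G. \<rho> y $$ (i, j) * \<rho> (inv y) $$ (k, l)) =
    (if i = l \<and> j = k then of_nat (card (carrier G)) / of_nat d else 0)"
proof -
  have mr: "matrix_rep G d \<rho>" and d: "d > 0" using \<rho> by (auto simp: irreducible_rep_def)
  note r = matrix_repD[OF mr]
  define T where "T = mat d d (\<lambda>(i, l). \<Sum>y\<in>carrier G. \<rho> y $$ (i, j) * \<rho> (inv y) $$ (k, l))"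
  have "\<exists>c. T = c \<cdot>\<^sub>m 1\<^sub>m d"
    using ijkl mr unfolding T_def by (intro intertwiner_scalar[OF \<rho>] averaged_intertwiner) auto
  then obtain c where c: "T = c \<cdot>\<^sub>m 1\<^sub>m d" by auto
  have "of_nat d * c = (\<Sum>p<d. T $$ (p, p))" by (simp add: c)
  also have "\<dots> = (\<Sum>p<d. \<Sum>y\<in>carrier G. \<rho> y $$ (p, j) * \<rho> (inv y) $$ (k, p))"
    by (simp add: T_def)
  also have "\<dots> = (\<Sum>y\<in>carrier G. (\<rho> (inv y) * \<rho> y) $$ (k, j))"
    using ijkl by (subst sum.swap) (simp add: mult_mat_entry[OF r(1) r(1)] mult.commute)
  also have "\<dots> = (\<Sum>y\<in>carrier G. 1\<^sub>m d $$ (k, j))"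
    by (intro sum.cong) (auto simp: r(2)[symmetric] r(3))
  also have "\<dots> = (if j = k then of_nat (card (carrier G)) else 0)" using ijkl by auto
  finally have "c = (if j = k then of_nat (card (carrier G)) / of_nat d else 0)"
    using d by (auto simp: field_simps)
  moreover have "T $$ (i, l) = (if i = l then c else 0)" using ijkl by (simp add: c)
  ultimately show ?thesis using ijkl by (simp add: T_def)
qed

section \<open>Convolution of irreducible characters\<close>

lemma rep_character_one: "matrix_rep G d \<rho> \<Longrightarrow> rep_character G d \<rho> \<one> = of_nat d"
  using matrix_repD(3)[of d \<rho>] by (simp add: rep_character_def)

lemma irr_character_one_nonzero: "\<chi> \<in> irr_characters G \<Longrightarrow> \<chi> \<one> \<noteq> 0"
  by (auto simp: irr_characters_def irreducible_rep_def rep_character_one)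

lemma rep_character_mult:
  assumes "matrix_rep G d \<rho>" "x \<in> carrier G" "y \<in> carrier G"
  shows "rep_character G d \<rho> (x \<otimes> y) = (\<Sum>a<d. \<Sum>b<d. \<rho> x $$ (a, b) * \<rho> y $$ (b, a))"
  using assms by (simp add: rep_character_def matrix_repD(2)[OF assms(1)]
      mult_mat_entry[OF matrix_repD(1)[OF assms(1)] matrix_repD(1)[OF assms(1)]])

text \<open>Writing both characters as traces of products turns the sum over \<open>y\<close> into
  the sums of entry products that Schur orthogonality evaluates. The free arguments \<open>x\<close>
  and \<open>z\<close> are what the multiplication of the idempotents needs.\<close>

lemma irr_character_convolution:
  assumes \<chi>: "\<chi> \<in> irr_characters G" and \<psi>: "\<psi> \<in> irr_characters G"
    and xz: "x \<in> carrier G" "z \<in> carrier G"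
  shows "(\<Sum>y\<in>carrier G. \<chi> (x \<otimes> y) * \<psi> (inv y \<otimes> z)) =
    (if \<chi> = \<psi> then of_nat (card (carrier G)) / \<chi> \<one> * \<chi> (x \<otimes> z) else 0)"
proof -
  \<comment> \<open>Stated for an arbitrary pair of representations. For
    \<open>\<chi> = \<psi>\<close> the same \<open>\<rho>\<close> is inserted twice, since equal
    characters alone do not give equal matrices.\<close>
  have expand: "(\<Sum>y\<in>carrier G. rep_character G e \<sigma> (x \<otimes> y) * rep_character G d \<rho> (inv y \<otimes> z)) =
    (\<Sum>a<e. \<Sum>b<e. \<Sum>c<d. \<Sum>f<d. \<sigma> x $$ (a, b) * \<rho> z $$ (f, c) *
      (\<Sum>y\<in>carrier G. \<sigma> y $$ (b, a) * \<rho> (inv y) $$ (c, f)))"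
    if "matrix_rep G e \<sigma>" "matrix_rep G d \<rho>" for e d \<sigma> \<rho>
  proof -
    have "(\<Sum>y\<in>carrier G. rep_character G e \<sigma> (x \<otimes> y) * rep_character G d \<rho> (inv y \<otimes> z)) =
      (\<Sum>y\<in>carrier G. \<Sum>a<e. \<Sum>b<e. \<Sum>c<d. \<Sum>f<d.
        \<sigma> x $$ (a, b) * \<rho> z $$ (f, c) * (\<sigma> y $$ (b, a) * \<rho> (inv y) $$ (c, f)))"
    proof (intro sum.cong refl)
      fix y assume "y \<in> carrier G"
      then have "rep_character G e \<sigma> (x \<otimes> y) * rep_character G d \<rho> (inv y \<otimes> z) =
        (\<Sum>a<e. \<Sum>b<e. \<sigma> x $$ (a, b) * \<sigma> y $$ (b, a)) *
        (\<Sum>c<d. \<Sum>f<d. \<rho> (inv y) $$ (c, f) * \<rho> z $$ (f, c))"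
        using that xz by (simp add: rep_character_mult)
      then show "rep_character G e \<sigma> (x \<otimes> y) * rep_character G d \<rho> (inv y \<otimes> z) =
        (\<Sum>a<e. \<Sum>b<e. \<Sum>c<d. \<Sum>f<d.
          \<sigma> x $$ (a, b) * \<rho> z $$ (f, c) * (\<sigma> y $$ (b, a) * \<rho> (inv y) $$ (c, f)))"
        unfolding sum_distrib_right unfolding sum_distrib_left by (simp only: mult_ac)
    qed
    also have "\<dots> = (\<Sum>a<e. \<Sum>b<e. \<Sum>c<d. \<Sum>f<d. \<Sum>y\<in>carrier G.
        \<sigma> x $$ (a, b) * \<rho> z $$ (f, c) * (\<sigma> y $$ (b, a) * \<rho> (inv y) $$ (c, f)))"
      by (subst sum.swap, rule sum.cong, rule refl)+ (rule refl)
    finally show ?thesis by (simp add: sum_distrib_left)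
  qed
  obtain d \<rho> where \<rho>: "irreducible_rep G d \<rho>" "\<psi> = rep_character G d \<rho>"
    using \<psi> by (auto simp: irr_characters_def)
  show ?thesis
  proof (cases "\<chi> = \<psi>")
    case True
    have mr: "matrix_rep G d \<rho>" using \<rho> by (simp add: irreducible_rep_def)
    let ?q = "of_nat (card (carrier G)) / of_nat d :: complex"
    have "(\<Sum>y\<in>carrier G. \<psi> (x \<otimes> y) * \<psi> (inv y \<otimes> z)) =
      (\<Sum>a<d. \<Sum>b<d. \<Sum>c<d. \<Sum>f<d. \<rho> x $$ (a, b) * \<rho> z $$ (f, c) *
        (if b = f \<and> a = c then ?q else 0))"
      unfolding \<rho>(2) expand[OF mr mr]
      by (intro sum.cong refl arg_cong2[of _ _ _ _ "(*)"] schur_orthogonality_same[OF \<rho>(1)]) auto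
    also have "\<dots> = (\<Sum>a<d. \<Sum>b<d. \<Sum>c<d. if a = c then \<rho> x $$ (a, b) * \<rho> z $$ (b, c) * ?q else 0)"
    proof (intro sum.cong refl)
      fix a b c assume "b \<in> {..<d}"
      have "(\<Sum>f<d. \<rho> x $$ (a, b) * \<rho> z $$ (f, c) * (if b = f \<and> a = c then ?q else 0)) =
        (\<Sum>f<d. if b = f then (if a = c then \<rho> x $$ (a, b) * \<rho> z $$ (f, c) * ?q else 0) else 0)"
        by (intro sum.cong) auto
      then show "(\<Sum>f<d. \<rho> x $$ (a, b) * \<rho> z $$ (f, c) * (if b = f \<and> a = c then ?q else 0)) =
        (if a = c then \<rho> x $$ (a, b) * \<rho> z $$ (b, c) * ?q else 0)"
        using \<open>b \<in> {..<d}\<close> by simp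
    qed
    also have "\<dots> = ?q * \<psi> (x \<otimes> z)"
      unfolding \<rho>(2) rep_character_mult[OF mr xz] by (simp add: sum_distrib_left mult_ac)
    finally show ?thesis using True \<rho>(2) mr by (simp add: rep_character_one)
  next
    case False
    obtain e \<sigma> where \<sigma>: "irreducible_rep G e \<sigma>" "\<chi> = rep_character G e \<sigma>"
      using \<chi> by (auto simp: irr_characters_def)
    have "(\<Sum>y\<in>carrier G. \<sigma> y $$ (b, a) * \<rho> (inv y) $$ (c, f)) = 0"
      if "a < e" "b < e" "c < d" "f < d" for a b c f
      using False \<rho> \<sigma> that by (intro schur_orthogonality_distinct) auto
    then show ?thesis using False \<rho> \<sigma> by (simp add: expand irreducible_rep_def)
  qed
qed

end

section \<open>Decomposition into irreducible characters\<close>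

text \<open>\<open>r\<close> is the dimension of \<open>W\<close>: the first \<open>r\<close>
  columns of \<open>P\<close> form a basis of \<open>W\<close>, and the others extend it to a basis
  of the whole space. As \<open>Q\<close> inverts \<open>P\<close>, the vector
  \<open>Q *\<^sub>v w\<close> lists the coordinates of \<open>w\<close>, and those of a member of
  \<open>W\<close> vanish from place \<open>r\<close> on.\<close>

lemma adapted_basis_change:
  assumes W: "VectorSpace.subspace class_ring W (module_vec TYPE('a::field) d)"
    and ne: "W \<noteq> {0\<^sub>v d}" "W \<noteq> carrier_vec d"
  obtains P Q r where "P \<in> carrier_mat d d" "Q \<in> carrier_mat d d" "P * Q = 1\<^sub>m d" "Q * P = 1\<^sub>m d"
    "0 < r" "r < d" "\<And>j. j < r \<Longrightarrow> col P j \<in> W"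
    "\<And>w i. w \<in> W \<Longrightarrow> r \<le> i \<Longrightarrow> i < d \<Longrightarrow> (Q *\<^sub>v w) $ i = 0"
proof -
  interpret V: vec_space "TYPE('a)" d .
  have Wc: "W \<subseteq> carrier_vec d" and W0: "0\<^sub>v d \<in> W" using W by (auto simp: subspace_vec_iff)
  have sub: "submodule class_ring W V.V" using W by (simp add: VectorSpace.subspace_def)
  have li_card: "finite S \<and> card S \<le> d" if "S \<subseteq> carrier_vec d" "V.lin_indpt S" for S
    using V.li_le_dim[OF V.fin_dim _ that(2)] that(1) V.dim_is_n by simp
  have li0: "V.lin_indpt {}"
    unfolding V.lin_dep_def by auto
  \<comment> \<open>A basis of \<open>W\<close> is obtained as a maximal independent subset; the
    bound \<open>d\<close> on the size of independent sets ensures that one exists.\<close>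
  have "\<exists>B. finite B \<and> maximal B (\<lambda>S. S \<subseteq> W \<and> V.lin_indpt S)"
    by (rule maximal_exists[of _ d "{}"]) (use li_card Wc li0 in blast)+
  then obtain B where B: "finite B" "maximal B (\<lambda>S. S \<subseteq> W \<and> V.lin_indpt S)" by blast
  have BW: "B \<subseteq> W" "V.lin_indpt B" and Bc: "B \<subseteq> carrier_vec d"
    using B(2) Wc by (auto simp: maximal_def)
  have WB: "W \<subseteq> V.span B"
  proof
    fix w assume w: "w \<in> W"
    show "w \<in> V.span B"
    proof (cases "w \<in> B")
      case True then show ?thesis using V.in_own_span[of B] Bc by auto
    next
      case False
      then have "V.lin_dep (B \<union> {w})"
        using B(2) BW w unfolding maximal_def by blast
      then show ?thesis using V.lin_dep_iff_in_span[of B w] Bc BW w Wc False by auto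
    qed
  qed
  have span_BW: "V.span B \<subseteq> W" using V.span_is_subset[OF BW(1) sub] .
  \<comment> \<open>A set maximal for \<open>Pc\<close> extends \<open>B\<close>. It is also maximal
    among all independent sets, because any larger set contains \<open>B\<close> as well.\<close>
  define Pc where "Pc = (\<lambda>S. S \<subseteq> carrier_vec d \<and> B \<subseteq> S \<and> V.lin_indpt S)"
  obtain C where C: "finite C" "maximal C Pc"
    using maximal_exists[of Pc d B] li_card BW Bc by (auto simp: Pc_def)
  have BC: "B \<subseteq> C" and Cc: "C \<subseteq> carrier_vec d" and Cli: "V.lin_indpt C"
    using C(2) by (auto simp: maximal_def Pc_def)
  have "maximal C (\<lambda>S. S \<subseteq> carrier_vec d \<and> V.lin_indpt S)"
    unfolding maximal_def
  proof (intro conjI allI impI)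
    fix S assume S: "C \<subseteq> S \<and> S \<subseteq> carrier_vec d \<and> V.lin_indpt S"
    then have "Pc S" using subset_trans[OF BC] unfolding Pc_def by simp
    then show "S = C" using S C(2) unfolding maximal_def by blast
  qed (use Cc Cli in simp_all)
  then have basis: "V.basis C" by (rule V.max_li_is_basis)
  then have gen: "V.span C = carrier_vec d" by (simp add: V.basis_def)
  have cardC: "card C = d" using V.dim_basis[OF C(1) basis] V.dim_is_n by simp
  obtain bs where bs: "set bs = B" "distinct bs" using finite_distinct_list[OF B(1)] by auto
  obtain cs where cs: "set cs = C - B" "distinct cs"
    using finite_distinct_list[of "C - B"] C(1) by auto
  define r where "r = length bs"
  define P where "P = mat_of_cols d (bs @ cs)"
  have len: "length (bs @ cs) = d"
    using distinct_card[of "bs @ cs"] bs cs cardC BC by (auto simp: Un_absorb1)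
  have P: "P \<in> carrier_mat d d" using len by (auto simp: P_def)
  have colsP: "cols P = bs @ cs"
    using bs cs Cc BC by (auto simp: P_def intro!: cols_mat_of_cols)
  have dist: "distinct (cols P)" and setP: "set (cols P) = C"
    using bs cs BC by (auto simp: colsP)
  have "V.rank P = d" using V.lin_indpt_full_rank[OF P dist] setP Cli by simp
  then have "det P \<noteq> 0" using V.det_rank_iff[OF P] by simp
  then have "P \<in> Units (ring_mat TYPE('a) d ())" by (rule det_non_zero_imp_unit[OF P])
  then obtain Q where Q: "Q \<in> carrier_mat d d" "P * Q = 1\<^sub>m d" "Q * P = 1\<^sub>m d"
    by (auto simp: Units_def ring_mat_simps)
  have "B \<noteq> {}" using W0 WB span_BW ne(1) by (auto simp: V.span_empty)
  then have r0: "0 < r" using bs by (auto simp: r_def)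
  have "C \<noteq> B" using gen span_BW ne(2) Wc by auto
  then have "cs \<noteq> []" using cs BC by auto
  then have rd: "r < d" using len by (cases cs) (auto simp: r_def)
  have colP: "col P j = (bs @ cs) ! j" if "j < d" for j
    using that P colsP by (metis cols_nth carrier_matD(2))
  show thesis
  proof (rule that[OF P Q r0 rd])
    fix j assume "j < r"
    then have "col P j = bs ! j" using colP rd by (auto simp: r_def nth_append)
    then show "col P j \<in> W" using \<open>j < r\<close> bs BW by (auto simp: r_def)
  next
    fix w i assume w: "w \<in> W" and i: "r \<le> i" "i < d"
    obtain a where a: "w = V.lincomb a B"
      using WB w V.finite_in_span[OF B(1), of w] Bc by auto
    \<comment> \<open>Extending the coefficients by zero from \<open>B\<close> to \<open>C\<close>
      makes the coordinates of \<open>w\<close> at the added basis vectors vanish.\<close>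
    define a' where "a' = (\<lambda>v. if v \<in> B then a v else 0)"
    have "V.lincomb a' C = V.lincomb a B"
    proof (rule eq_vecI)
      fix k assume "k < dim_vec (V.lincomb a B)"
      then have k: "k < d" using V.lincomb_dim[OF B(1) Bc] by simp
      have "(\<Sum>x\<in>C. a' x * x $ k) = (\<Sum>x\<in>B. a x * x $ k)"
        using BC C(1) by (intro sum.mono_neutral_cong_right) (auto simp: a'_def)
      then show "V.lincomb a' C $ k = V.lincomb a B $ k"
        using V.lincomb_index[OF k Cc] V.lincomb_index[OF k Bc] by simp
    qed (use V.lincomb_dim[OF B(1) Bc] V.lincomb_dim[OF C(1) Cc] in auto)
    then have "w = P *\<^sub>v vec d (\<lambda>i. a' (col P i))"
      using V.mat_mult_eq_lincomb[OF P dist, of a'] a setP by simp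
    then have "Q *\<^sub>v w = (Q * P) *\<^sub>v vec d (\<lambda>i. a' (col P i))"
      by (simp only: assoc_mult_mat_vec[OF Q(1) P vec_carrier])
    also have "\<dots> = vec d (\<lambda>i. a' (col P i))" using Q by simp
    finally have "(Q *\<^sub>v w) $ i = a' (col P i)" using i by simp
    moreover have "col P i \<in> C - B"
    proof -
      have "col P i = cs ! (i - r)" "i - r < length cs"
        using colP[OF i(2)] i len by (simp_all add: r_def nth_append)
      then show ?thesis using nth_mem[of "i - r" cs] cs(1) by simp
    qed
    ultimately show "(Q *\<^sub>v w) $ i = 0" by (simp add: a'_def)
  qed
qed

lemma sum_lessThan_split:
  fixes f :: "nat \<Rightarrow> 'a::comm_monoid_add"
  assumes "r \<le> d"
  shows "(\<Sum>i<d. f i) = (\<Sum>i<r. f i) + (\<Sum>i<d - r. f (r + i))"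
proof -
  have "(\<Sum>i<r + m. f i) = (\<Sum>i<r. f i) + (\<Sum>i<m. f (r + i))" for m
    by (induction m) (simp_all add: add.assoc)
  from this[of "d - r"] show ?thesis using assms by simp
qed

context finite_group
begin

lemma rep_conj:
  assumes \<rho>: "matrix_rep G d \<rho>" and P: "P \<in> carrier_mat d d" and Q: "Q \<in> carrier_mat d d"
    and PQ: "P * Q = 1\<^sub>m d" and QP: "Q * P = 1\<^sub>m d"
  shows "matrix_rep G d (\<lambda>g. Q * (\<rho> g * P))"
    and "rep_character G d (\<lambda>g. Q * (\<rho> g * P)) = rep_character G d \<rho>"
proof -
  note r = matrix_repD[OF \<rho>]
  show "matrix_rep G d (\<lambda>g. Q * (\<rho> g * P))"
  proof (rule matrix_repI)
    show "Q * (\<rho> g * P) \<in> carrier_mat d d" if "g \<in> carrier G" for g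
      using P Q r(1)[OF that] by auto
    show "Q * (\<rho> (g \<otimes> h) * P) = Q * (\<rho> g * P) * (Q * (\<rho> h * P))"
      if g: "g \<in> carrier G" "h \<in> carrier G" for g h
    proof -
      note c = r(1)[OF g(1)] r(1)[OF g(2)] P Q
      have gP: "\<rho> g * P \<in> carrier_mat d d" and hP: "\<rho> h * P \<in> carrier_mat d d"
        and QhP: "Q * (\<rho> h * P) \<in> carrier_mat d d" using c by auto
      have "Q * (\<rho> g * P) * (Q * (\<rho> h * P)) = Q * (\<rho> g * (P * (Q * (\<rho> h * P))))"
        by (simp only: assoc_mult_mat[OF Q gP QhP] assoc_mult_mat[OF c(1) P QhP])
      also have "P * (Q * (\<rho> h * P)) = \<rho> h * P"
        using assoc_mult_mat[OF P Q hP] PQ left_mult_one_mat[OF hP] by simp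
      also have "\<rho> g * (\<rho> h * P) = \<rho> (g \<otimes> h) * P"
        using assoc_mult_mat[OF c(1,2) P] r(2)[OF g] by simp
      finally show ?thesis by simp
    qed
    show "Q * (\<rho> \<one> * P) = 1\<^sub>m d" using P QP by (simp add: r(3))
  qed
  show "rep_character G d (\<lambda>g. Q * (\<rho> g * P)) = rep_character G d \<rho>"
  proof
    fix g show "rep_character G d (\<lambda>g. Q * (\<rho> g * P)) g = rep_character G d \<rho> g"
    proof (cases "g \<in> carrier G")
      case g: True
      have gP: "\<rho> g * P \<in> carrier_mat d d" using r(1)[OF g] P by auto
      have "(\<Sum>i<d. (Q * (\<rho> g * P)) $$ (i, i)) = (\<Sum>i<d. (\<rho> g * P * Q) $$ (i, i))"
        by (rule sum_diag_mult_commute[OF Q gP])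
      also have "\<rho> g * P * Q = \<rho> g"
        using assoc_mult_mat[OF r(1)[OF g] P Q] PQ r(1)[OF g] by simp
      finally show ?thesis using g by (simp add: rep_character_def)
    qed (simp add: rep_character_def)
  qed
qed

text \<open>A proper nonzero invariant subspace carries a subrepresentation and leaves a quotient
  representation. Both have smaller degree, and their traces add up to that of
  \<open>\<rho>\<close>.\<close>

lemma reducible_character_split:
  assumes \<rho>: "matrix_rep G d \<rho>" and "d > 0" and nirr: "\<not> irreducible_rep G d \<rho>"
  obtains d1 \<rho>1 d2 \<rho>2 where "d1 < d" "matrix_rep G d1 \<rho>1" "d2 < d" "matrix_rep G d2 \<rho>2"
    "\<And>g. g \<in> carrier G \<Longrightarrow> rep_character G d \<rho> g = rep_character G d1 \<rho>1 g + rep_character G d2 \<rho>2 g"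
proof -
  obtain W where W: "VectorSpace.subspace class_ring W (module_vec TYPE(complex) d)"
    and inv: "\<And>g w. g \<in> carrier G \<Longrightarrow> w \<in> W \<Longrightarrow> \<rho> g *\<^sub>v w \<in> W"
    and ne: "W \<noteq> {0\<^sub>v d}" "W \<noteq> carrier_vec d"
    using nirr \<rho> \<open>d > 0\<close> unfolding irreducible_rep_def by blast
  from adapted_basis_change[OF W ne] obtain P Q r where
    P: "P \<in> carrier_mat d d" and Q: "Q \<in> carrier_mat d d" and PQ: "P * Q = 1\<^sub>m d" and QP: "Q * P = 1\<^sub>m d"
    and r: "0 < r" "r < d" and colW: "\<And>j. j < r \<Longrightarrow> col P j \<in> W"
    and Q0: "\<And>w i. w \<in> W \<Longrightarrow> r \<le> i \<Longrightarrow> i < d \<Longrightarrow> (Q *\<^sub>v w) $ i = 0" by metis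
  define A where "A = (\<lambda>g. Q * (\<rho> g * P))"
  have A: "matrix_rep G d A" and Achar: "rep_character G d A = rep_character G d \<rho>"
    using rep_conj[OF \<rho> P Q PQ QP] by (auto simp: A_def)
  note a = matrix_repD[OF A]
  \<comment> \<open>\<open>\<rho> g\<close> keeps the first \<open>r\<close> columns of
    \<open>P\<close> inside \<open>W\<close>, where the coordinates from \<open>r\<close> on are
    zero.\<close>
  have A0: "A g $$ (i, j) = 0" if g: "g \<in> carrier G" and ij: "j < r" "r \<le> i" "i < d" for g i j
  proof -
    note c = matrix_repD(1)[OF \<rho> g]
    have "A g $$ (i, j) = (Q *\<^sub>v (\<rho> g *\<^sub>v col P j)) $ i"
      using c P Q ij r by (simp add: A_def mult_mat_vec_def)
    then show ?thesis using Q0[OF inv[OF g colW]] ij by simp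
  qed
  have Amult: "A (g \<otimes> h) $$ (i, j) =
      (\<Sum>k<r. A g $$ (i, k) * A h $$ (k, j)) + (\<Sum>k<d - r. A g $$ (i, r + k) * A h $$ (r + k, j))"
    if "g \<in> carrier G" "h \<in> carrier G" "i < d" "j < d" for g h i j
    using that r by (simp add: a(2) mult_mat_entry[OF a(1) a(1)] sum_lessThan_split[of r d])
  \<comment> \<open>By \<open>A0\<close>, each \<open>A g\<close> is block upper triangular; the diagonal blocks are the two constituents.\<close>
  define A1 where "A1 = (\<lambda>g. mat r r (\<lambda>(i, j). A g $$ (i, j)))"
  define A2 where "A2 = (\<lambda>g. mat (d - r) (d - r) (\<lambda>(i, j). A g $$ (r + i, r + j)))"
  have A1c: "A1 g \<in> carrier_mat r r" for g by (simp add: A1_def)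
  have A2c: "A2 g \<in> carrier_mat (d - r) (d - r)" for g by (simp add: A2_def)
  have "matrix_rep G r A1"
  proof (rule matrix_repI)
    show "A1 (g \<otimes> h) = A1 g * A1 h" if g: "g \<in> carrier G" "h \<in> carrier G" for g h
    proof (rule eq_matI)
      fix i j assume "i < dim_row (A1 g * A1 h)" "j < dim_col (A1 g * A1 h)"
      then have ij: "i < r" "j < r" by (auto simp: A1_def)
      show "A1 (g \<otimes> h) $$ (i, j) = (A1 g * A1 h) $$ (i, j)"
        using ij r g A0[OF g(2)] unfolding mult_mat_entry[OF A1c A1c ij] by (simp add: A1_def Amult)
    qed (auto simp: A1_def)
    show "A1 \<one> = 1\<^sub>m r" using r by (auto simp: A1_def a(3))
  qed (rule A1c)
  moreover have "matrix_rep G (d - r) A2"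
  proof (rule matrix_repI)
    show "A2 (g \<otimes> h) = A2 g * A2 h" if g: "g \<in> carrier G" "h \<in> carrier G" for g h
    proof (rule eq_matI)
      fix i j assume "i < dim_row (A2 g * A2 h)" "j < dim_col (A2 g * A2 h)"
      then have ij: "i < d - r" "j < d - r" by (auto simp: A2_def)
      show "A2 (g \<otimes> h) $$ (i, j) = (A2 g * A2 h) $$ (i, j)"
        using ij r g A0[OF g(1)] unfolding mult_mat_entry[OF A2c A2c ij] by (simp add: A2_def Amult)
    qed (auto simp: A2_def)
    show "A2 \<one> = 1\<^sub>m (d - r)" using r by (auto simp: A2_def a(3))
  qed (rule A2c)
  moreover have "rep_character G d \<rho> g = rep_character G r A1 g + rep_character G (d - r) A2 g"
    if "g \<in> carrier G" for g
    using that r unfolding Achar[symmetric]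
    by (simp add: rep_character_def sum_lessThan_split[of r d] A1_def A2_def)
  ultimately show thesis using r that[of r A1 "d - r" A2] by auto
qed

text \<open>Strong induction on the degree: reducible characters are split, and the multiplicities
  of the two parts add up. The premise \<open>fin\<close> gives the sum its meaning, as a sum over
  an infinite set is 0 by default.\<close>

lemma rep_character_decomposition:
  assumes fin: "finite (irr_characters G)" and \<rho>: "matrix_rep G d \<rho>"
  shows "\<exists>m :: ('g \<Rightarrow> complex) \<Rightarrow> nat. \<forall>g\<in>carrier G.
    rep_character G d \<rho> g = (\<Sum>\<psi>\<in>irr_characters G. of_nat (m \<psi>) * \<psi> g)"
  using \<rho>
proof (induction d arbitrary: \<rho> rule: less_induct)
  case (less d)
  consider "d = 0" | "irreducible_rep G d \<rho>" | "d > 0" "\<not> irreducible_rep G d \<rho>" by blast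
  then show ?case
  proof cases
    \<comment> \<open>Degree 0 is allowed by \<open>matrix_rep\<close> but is never irreducible; its
      character is zero and gets all multiplicities 0.\<close>
    case 1
    then show ?thesis by (intro exI[of _ "\<lambda>_. 0"]) (simp add: rep_character_def)
  next
    case 2
    let ?\<theta> = "rep_character G d \<rho>"
    have "?\<theta> \<in> irr_characters G" using 2 by (auto simp: irr_characters_def)
    then have "(\<Sum>\<psi>\<in>irr_characters G. of_nat (if \<psi> = ?\<theta> then 1 else 0) * \<psi> g) = ?\<theta> g" for g
      using fin by (simp add: if_distrib[of of_nat] if_distrib[of "\<lambda>x. x * _"] cong: if_cong)
    then show ?thesis by (intro exI[of _ "\<lambda>\<psi>. if \<psi> = ?\<theta> then 1 else 0"]) simp
  next
    case 3
    from reducible_character_split[OF less.prems 3] obtain d1 \<rho>1 d2 \<rho>2 where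
      s: "d1 < d" "matrix_rep G d1 \<rho>1" "d2 < d" "matrix_rep G d2 \<rho>2"
      "\<And>g. g \<in> carrier G \<Longrightarrow> rep_character G d \<rho> g = rep_character G d1 \<rho>1 g + rep_character G d2 \<rho>2 g"
      by metis
    obtain m1 :: "('g \<Rightarrow> complex) \<Rightarrow> nat" where
      m1: "\<forall>g\<in>carrier G. rep_character G d1 \<rho>1 g = (\<Sum>\<psi>\<in>irr_characters G. of_nat (m1 \<psi>) * \<psi> g)"
      using less.IH[OF s(1,2)] by (elim exE)
    obtain m2 :: "('g \<Rightarrow> complex) \<Rightarrow> nat" where
      m2: "\<forall>g\<in>carrier G. rep_character G d2 \<rho>2 g = (\<Sum>\<psi>\<in>irr_characters G. of_nat (m2 \<psi>) * \<psi> g)"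
      using less.IH[OF s(3,4)] by (elim exE)
    from m1 m2 show ?thesis using s(5)
      by (intro exI[of _ "\<lambda>\<psi>. m1 \<psi> + m2 \<psi>"]) (simp add: sum.distrib distrib_right)
  qed
qed

end

section \<open>Column spaces\<close>

lemma class_ring_cring: "cring (class_ring :: complex ring)"
  by (rule class_cring.is_cring)

lemma complex_fun_space_simps:
  "carrier (complex_fun_space X) = X \<rightarrow>\<^sub>E UNIV"
  "f \<oplus>\<^bsub>complex_fun_space X\<^esub> g = (\<lambda>x\<in>X. f x + g x)"
  "c \<odot>\<^bsub>complex_fun_space X\<^esub> f = (\<lambda>x\<in>X. c * f x)"
  "\<zero>\<^bsub>complex_fun_space X\<^esub> = (\<lambda>x\<in>X. 0)"
  by (simp_all add: ring.func_space_def[OF cring.axioms(1)[OF class_ring_cring]])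

lemma complex_fun_space_module: "Module.module class_ring (complex_fun_space X)"
  by (rule cring.func_space_is_module[OF class_ring_cring])

lemma complex_fun_space_finsum:
  assumes "finite I" "\<And>k. k \<in> I \<Longrightarrow> u k \<in> X \<rightarrow>\<^sub>E UNIV"
  shows "(\<Oplus>\<^bsub>complex_fun_space X\<^esub>k\<in>I. u k) = (\<lambda>x\<in>X. \<Sum>k\<in>I. u k x)"
proof -
  interpret M: Module.module class_ring "complex_fun_space X" by (rule complex_fun_space_module)
  show ?thesis using assms
  proof (induction I rule: finite_induct)
    case empty
    then show ?case by (simp add: complex_fun_space_simps)
  next
    case (insert k I)
    then show ?case
      by (subst M.finsum_insert) (auto simp: complex_fun_space_simps intro!: restrict_ext)
  qed
qed

lemma column_space_subspace:
  "VectorSpace.subspace class_ring (column_space X Y A) (complex_fun_space X)"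
proof -
  interpret M: Module.module class_ring "complex_fun_space X" by (rule complex_fun_space_module)
  have "submodule class_ring (column_space X Y A) (complex_fun_space X)"
    unfolding column_space_def
    by (rule M.span_is_submodule) (auto simp: complex_fun_space_simps)
  moreover have "vectorspace class_ring (complex_fun_space X)"
    using complex_fun_space_module[of X] class_field by (simp only: vectorspace_def)
  ultimately show ?thesis by (simp add: VectorSpace.subspace_def)
qed

text \<open>Replaces the span by the image of the matrix acting on coefficient functions. The
  coefficients are indexed by \<open>Y\<close> and not by the set of columns, so repeated columns do
  no harm.\<close>

lemma column_space_eq:
  assumes "finite Y"
  shows "column_space X Y A = range (\<lambda>c. \<lambda>x\<in>X. \<Sum>y\<in>Y. c y * A x y)"
proof
  interpret M: Module.module class_ring "complex_fun_space X" by (rule complex_fun_space_module)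
  let ?S = "range (\<lambda>c. \<lambda>x\<in>X. \<Sum>y\<in>Y. c y * A x y)"
  let ?cols = "(\<lambda>y. \<lambda>x\<in>X. A x y) ` Y"
  show "column_space X Y A \<subseteq> ?S"
    unfolding column_space_def
  proof (rule M.span_is_subset)
    show "?cols \<subseteq> ?S"
    proof clarify
      fix y assume "y \<in> Y"
      then have "(\<Sum>y'\<in>Y. (if y' = y then 1 else 0) * A x y') = A x y" for x
        using assms by (simp add: if_distrib[of "\<lambda>c. c * _"] cong: if_cong)
      then show "(\<lambda>x\<in>X. A x y) \<in> ?S"
        by (intro range_eqI[of _ _ "\<lambda>y'. if y' = y then 1 else 0"]) simp
    qed
    show "submodule class_ring ?S (complex_fun_space X)"
    proof (rule submodule.intro[OF complex_fun_space_module])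
      show "?S \<subseteq> carrier (complex_fun_space X)" by (auto simp: complex_fun_space_simps)
      show "\<zero>\<^bsub>complex_fun_space X\<^esub> \<in> ?S"
        by (intro range_eqI[of _ _ "\<lambda>_. 0"]) (simp add: complex_fun_space_simps)
    next
      fix v w assume "v \<in> ?S" "w \<in> ?S"
      then obtain c c' where "v = (\<lambda>x\<in>X. \<Sum>y\<in>Y. c y * A x y)" "w = (\<lambda>x\<in>X. \<Sum>y\<in>Y. c' y * A x y)"
        by auto
      then show "v \<oplus>\<^bsub>complex_fun_space X\<^esub> w \<in> ?S"
        by (intro range_eqI[of _ _ "\<lambda>y. c y + c' y"])
          (auto simp: complex_fun_space_simps sum.distrib distrib_right intro!: restrict_ext)
    next
      fix k v assume "v \<in> ?S"
      then obtain c where "v = (\<lambda>x\<in>X. \<Sum>y\<in>Y. c y * A x y)" by auto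
      then show "k \<odot>\<^bsub>complex_fun_space X\<^esub> v \<in> ?S"
        by (intro range_eqI[of _ _ "\<lambda>y. k * c y"])
          (auto simp: complex_fun_space_simps sum_distrib_left mult.assoc intro!: restrict_ext)
    qed
  qed
  have sub: "submodule class_ring (M.span ?cols) (complex_fun_space X)"
    by (rule M.span_is_submodule) (auto simp: complex_fun_space_simps)
  have cols: "?cols \<subseteq> M.span ?cols"
    by (rule M.in_own_span) (auto simp: complex_fun_space_simps)
  \<comment> \<open>Generalised to finite subsets \<open>F\<close> of \<open>Y\<close> for the
    induction; \<open>F = Y\<close> gives the remaining inclusion.\<close>
  have "(\<lambda>x\<in>X. \<Sum>y\<in>F. c y * A x y) \<in> M.span ?cols" if "finite F" "F \<subseteq> Y" for F c
    using that
  proof (induction F rule: finite_induct)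
    case empty
    then show ?case using submodule.zero_closed[OF sub] by (simp only: complex_fun_space_simps sum.empty)
  next
    case (insert y F)
    have "c y \<odot>\<^bsub>complex_fun_space X\<^esub> (\<lambda>x\<in>X. A x y) \<in> M.span ?cols"
      using submodule.smult_closed[OF sub] cols insert.prems by auto
    then have "c y \<odot>\<^bsub>complex_fun_space X\<^esub> (\<lambda>x\<in>X. A x y) \<oplus>\<^bsub>complex_fun_space X\<^esub>
        (\<lambda>x\<in>X. \<Sum>y\<in>F. c y * A x y) \<in> M.span ?cols"
      using insert.prems by (intro submodule.m_closed[OF sub] insert.IH) auto
    moreover have "c y \<odot>\<^bsub>complex_fun_space X\<^esub> (\<lambda>x\<in>X. A x y) \<oplus>\<^bsub>complex_fun_space X\<^esub>
        (\<lambda>x\<in>X. \<Sum>y\<in>F. c y * A x y) = (\<lambda>x\<in>X. \<Sum>y\<in>insert y F. c y * A x y)"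
      using insert by (auto simp: complex_fun_space_simps intro!: restrict_ext)
    ultimately show ?case by (simp only:)
  qed
  then show "?S \<subseteq> column_space X Y A"
    using assms by (auto simp: column_space_def)
qed

lemma column_space_sum:
  assumes "finite Y" "finite J" and F: "\<And>i. i \<in> J \<Longrightarrow> (\<lambda>x\<in>X. F i x) \<in> column_space X Y A"
  shows "(\<lambda>x\<in>X. \<Sum>i\<in>J. c i * F i x) \<in> column_space X Y A"
proof -
  have "\<exists>k. \<forall>x\<in>X. F i x = (\<Sum>y\<in>Y. k y * A x y)" if "i \<in> J" for i
    using F[OF that] unfolding column_space_eq[OF assms(1)] by (auto simp: fun_eq_iff) metis
  then obtain k where k: "\<And>i x. i \<in> J \<Longrightarrow> x \<in> X \<Longrightarrow> F i x = (\<Sum>y\<in>Y. k i y * A x y)" by metis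
  have "(\<Sum>i\<in>J. c i * F i x) = (\<Sum>y\<in>Y. (\<Sum>i\<in>J. c i * k i y) * A x y)" if "x \<in> X" for x
  proof -
    have "(\<Sum>i\<in>J. c i * F i x) = (\<Sum>i\<in>J. \<Sum>y\<in>Y. c i * k i y * A x y)"
      using k that by (simp add: sum_distrib_left mult.assoc)
    also have "\<dots> = (\<Sum>y\<in>Y. (\<Sum>i\<in>J. c i * k i y) * A x y)"
      by (subst sum.swap) (simp add: sum_distrib_right)
    finally show ?thesis .
  qed
  then show ?thesis unfolding column_space_eq[OF assms(1)]
    by (intro range_eqI[of _ _ "\<lambda>y. \<Sum>i\<in>J. c i * k i y"]) (auto intro!: restrict_ext)
qed

lemma column_in_column_space:
  assumes "y \<in> Y"
  shows "(\<lambda>x\<in>X. A x y) \<in> column_space X Y A"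
proof -
  interpret M: Module.module class_ring "complex_fun_space X" by (rule complex_fun_space_module)
  have "(\<lambda>y. \<lambda>x\<in>X. A x y) ` Y \<subseteq> column_space X Y A"
    unfolding column_space_def by (rule M.in_own_span) (auto simp: complex_fun_space_simps)
  then show ?thesis using assms by auto
qed

section \<open>The idempotents of the conjugacy class scheme\<close>

context finite_group
begin

text \<open>Not stated for \<^locale>\<open>group_action\<close>, whose maps must be extensional: this way it also
  applies to the group operation itself.\<close>

lemma perm_character_is_rep_character:
  assumes E: "finite E"
    and closed: "\<And>g x. g \<in> carrier G \<Longrightarrow> x \<in> E \<Longrightarrow> \<phi> g x \<in> E"
    and one: "\<And>x. x \<in> E \<Longrightarrow> \<phi> \<one> x = x"
    and mult: "\<And>g h x. g \<in> carrier G \<Longrightarrow> h \<in> carrier G \<Longrightarrow> x \<in> E \<Longrightarrow> \<phi> (g \<otimes> h) x = \<phi> g (\<phi> h x)"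
  shows "\<exists>\<rho>. matrix_rep G (card E) \<rho> \<and> rep_character G (card E) \<rho> = perm_character G E \<phi>"
proof -
  let ?d = "card E"
  obtain e where e: "bij_betw e {..<?d} E"
    using ex_bij_betw_nat_finite[OF E] by (auto simp: atLeast0LessThan)
  have eE: "e i \<in> E" if "i < ?d" for i using e that by (auto simp: bij_betw_def)
  have einj: "e i = e j \<longleftrightarrow> i = j" if "i < ?d" "j < ?d" for i j
    using e that by (auto simp: bij_betw_def inj_on_def)
  define \<rho> where "\<rho> = (\<lambda>g. mat ?d ?d (\<lambda>(i, j). if \<phi> g (e j) = e i then 1 else 0 :: complex))"
  have c: "\<rho> g \<in> carrier_mat ?d ?d" for g by (simp add: \<rho>_def)
  have "matrix_rep G ?d \<rho>"
  proof (rule matrix_repI)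
    show "\<rho> (g \<otimes> h) = \<rho> g * \<rho> h" if g: "g \<in> carrier G" "h \<in> carrier G" for g h
    proof (rule eq_matI)
      fix i j assume "i < dim_row (\<rho> g * \<rho> h)" "j < dim_col (\<rho> g * \<rho> h)"
      then have ij: "i < ?d" "j < ?d" by (auto simp: \<rho>_def)
      \<comment> \<open>\<open>k\<close> is the number of the point \<open>\<phi> h (e j)\<close>.
        Column \<open>j\<close> of \<open>\<rho> h\<close> has its only 1 in row \<open>k\<close>,
        so the sum for the matrix product collapses to \<open>l = k\<close>.\<close>
      obtain k where k: "k < ?d" "e k = \<phi> h (e j)"
        using closed[OF g(2) eE[OF ij(2)]] bij_betw_imp_surj_on[OF e]
        by (metis imageE lessThan_iff)
      have "(\<rho> g * \<rho> h) $$ (i, j) = (\<Sum>l<?d. if l = k then \<rho> g $$ (i, k) else 0)"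
        unfolding mult_mat_entry[OF c c ij]
        using ij k by (intro sum.cong) (auto simp: \<rho>_def einj k(2)[symmetric])
      also have "\<dots> = \<rho> (g \<otimes> h) $$ (i, j)"
        using k ij g by (simp add: \<rho>_def mult eE)
      finally show "\<rho> (g \<otimes> h) $$ (i, j) = (\<rho> g * \<rho> h) $$ (i, j)" by simp
    qed (auto simp: \<rho>_def)
    show "\<rho> \<one> = 1\<^sub>m ?d"
      by (rule eq_matI) (auto simp: \<rho>_def one eE einj)
  qed (rule c)
  moreover have "rep_character G ?d \<rho> g = perm_character G E \<phi> g" for g
  proof (cases "g \<in> carrier G")
    case True
    have "(\<Sum>i<?d. \<rho> g $$ (i, i)) = (\<Sum>i<?d. if \<phi> g (e i) = e i then 1 else 0)"
      by (simp add: \<rho>_def)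
    also have "\<dots> = (\<Sum>x\<in>E. if \<phi> g x = x then 1 else 0)"
      by (rule sum.reindex_bij_betw[OF e])
    also have "\<dots> = of_nat (card (invariants E \<phi> g))"
      using E by (simp add: invariants_def sum.If_cases Int_def)
    finally show ?thesis using True by (simp add: rep_character_def perm_character_def)
  qed (simp add: rep_character_def perm_character_def)
  ultimately show ?thesis by blast
qed

section \<open>Multiplicities and the regular character\<close>

text \<open>Convolution is linear and only the summand \<open>\<psi> = \<chi>\<close> survives, so
  convolving with \<open>\<chi>\<close> reads off the multiplicity of \<open>\<chi>\<close> in
  \<open>\<theta>\<close>.\<close>

lemma multiplicity_convolution:
  assumes fin: "finite (irr_characters G)" and \<chi>: "\<chi> \<in> irr_characters G"
    and \<theta>: "\<And>g. g \<in> carrier G \<Longrightarrow> \<theta> g = (\<Sum>\<psi>\<in>irr_characters G. of_nat (m \<psi>) * \<psi> g)"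
    and xz: "x \<in> carrier G" "z \<in> carrier G"
  shows "(\<Sum>y\<in>carrier G. \<chi> (x \<otimes> y) * \<theta> (inv y \<otimes> z)) =
    of_nat (m \<chi>) * of_nat (card (carrier G)) / \<chi> \<one> * \<chi> (x \<otimes> z)"
proof -
  have "(\<Sum>y\<in>carrier G. \<chi> (x \<otimes> y) * \<theta> (inv y \<otimes> z)) =
    (\<Sum>\<psi>\<in>irr_characters G. of_nat (m \<psi>) * (\<Sum>y\<in>carrier G. \<chi> (x \<otimes> y) * \<psi> (inv y \<otimes> z)))"
    unfolding sum_distrib_left using xz
    by (subst sum.swap) (auto intro!: sum.cong simp: \<theta> sum_distrib_left mult_ac)
  also have "\<dots> = (\<Sum>\<psi>\<in>irr_characters G. if \<psi> = \<chi> then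
      of_nat (m \<chi>) * of_nat (card (carrier G)) / \<chi> \<one> * \<chi> (x \<otimes> z) else 0)"
    using \<chi> xz by (intro sum.cong) (auto simp: irr_character_convolution)
  finally show ?thesis using fin \<chi> by simp
qed

lemma card_carrier_nonzero: "card (carrier G) \<noteq> 0"
  using finite_carrier one_closed by auto

text \<open>The convolution at \<open>\<one>\<close> determines \<open>m \<chi>\<close>, because
  \<open>\<chi> \<one>\<close> and |G| are nonzero. Hence any one decomposition decides whether
  \<open>irr_constituent\<close> holds.\<close>

lemma multiplicity_unique:
  assumes "finite (irr_characters G)" and \<chi>: "\<chi> \<in> irr_characters G"
    and "\<And>g. g \<in> carrier G \<Longrightarrow> \<theta> g = (\<Sum>\<psi>\<in>irr_characters G. of_nat (m \<psi>) * \<psi> g)"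
    and "\<And>g. g \<in> carrier G \<Longrightarrow> \<theta> g = (\<Sum>\<psi>\<in>irr_characters G. of_nat (m' \<psi>) * \<psi> g)"
  shows "m \<chi> = m' \<chi>"
proof -
  have "(of_nat (m \<chi>) * of_nat (card (carrier G)) / \<chi> \<one> * \<chi> (\<one> \<otimes> \<one>) :: complex) =
      of_nat (m' \<chi>) * of_nat (card (carrier G)) / \<chi> \<one> * \<chi> (\<one> \<otimes> \<one>)"
    using multiplicity_convolution[OF assms(1,2), of \<theta> m \<one> \<one>]
      multiplicity_convolution[OF assms(1,2), of \<theta> m' \<one> \<one>] assms(3,4) by simp
  then show ?thesis using irr_character_one_nonzero[OF \<chi>] card_carrier_nonzero by simp
qed

text \<open>In the regular character \<open>?reg\<close> the multiplicity of \<open>\<chi>\<close>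
  is \<open>\<chi> \<one>\<close>. The sum is therefore \<open>?reg (inv x \<otimes> y)\<close>
  divided by |G|, and \<open>?reg\<close> is |G| at \<open>\<one>\<close> and 0 elsewhere.\<close>

lemma scheme_idempotent_sum:
  assumes fin: "finite (irr_characters G)" and xy: "x \<in> carrier G" "y \<in> carrier G"
  shows "(\<Sum>\<chi>\<in>irr_characters G. scheme_idempotent G \<chi> x y) = (if x = y then 1 else 0)"
proof -
  let ?n = "of_nat (card (carrier G)) :: complex"
  let ?reg = "perm_character G (carrier G) (\<otimes>)"
  have reg: "?reg g = (if g = \<one> then ?n else 0)" if g: "g \<in> carrier G" for g
  proof -
    have "invariants (carrier G) (\<otimes>) g = (if g = \<one> then carrier G else {})"
      using g by (auto simp: invariants_def)
    then show ?thesis using g by (simp add: perm_character_def)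
  qed
  have "\<exists>\<rho>. matrix_rep G (card (carrier G)) \<rho> \<and> rep_character G (card (carrier G)) \<rho> = ?reg"
    by (rule perm_character_is_rep_character) (auto simp: finite_carrier m_assoc)
  then obtain m :: "('g \<Rightarrow> complex) \<Rightarrow> nat" where
    m: "\<And>g. g \<in> carrier G \<Longrightarrow> ?reg g = (\<Sum>\<psi>\<in>irr_characters G. of_nat (m \<psi>) * \<psi> g)"
    using rep_character_decomposition[OF fin] by metis
  \<comment> \<open>The convolution of \<open>\<chi>\<close> with the regular character at
    \<open>\<one>\<close> has a single nonzero term; comparing it with
    \<open>multiplicity_convolution\<close> yields the degree.\<close>
  have m1: "of_nat (m \<chi>) = \<chi> \<one>" if \<chi>: "\<chi> \<in> irr_characters G" for \<chi>
  proof -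
    have "(\<Sum>y\<in>carrier G. \<chi> (\<one> \<otimes> y) * ?reg (inv y \<otimes> \<one>)) = (\<Sum>y\<in>carrier G. if y = \<one> then ?n * \<chi> \<one> else 0)"
      by (intro sum.cong) (auto simp: reg)
    also have "\<dots> = ?n * \<chi> \<one>" using finite_carrier by simp
    finally have "?n * \<chi> \<one> = of_nat (m \<chi>) * ?n / \<chi> \<one> * \<chi> (\<one> \<otimes> \<one>)"
      using multiplicity_convolution[OF fin \<chi>, of ?reg m \<one> \<one>] m by simp
    then show ?thesis using irr_character_one_nonzero[OF \<chi>] card_carrier_nonzero by simp
  qed
  have "(\<Sum>\<chi>\<in>irr_characters G. scheme_idempotent G \<chi> x y) = ?reg (inv x \<otimes> y) / ?n"
    using xy m1 by (simp add: m scheme_idempotent_def sum_divide_distrib)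
  moreover have "inv x \<otimes> y = \<one> \<longleftrightarrow> x = y"
    using xy by (metis inv_closed inv_equality inv_inv l_inv)
  ultimately show ?thesis using xy card_carrier_nonzero by (simp add: reg)
qed

section \<open>Projections onto the eigenspaces\<close>

definition scheme_projection :: "('g \<Rightarrow> complex) \<Rightarrow> ('g \<Rightarrow> complex) \<Rightarrow> 'g \<Rightarrow> complex" where
  "scheme_projection \<chi> f = (\<lambda>x\<in>carrier G. \<Sum>y\<in>carrier G. scheme_idempotent G \<chi> x y * f y)"

lemma scheme_eigenspace_eq: "scheme_eigenspace G \<chi> = range (scheme_projection \<chi>)"
  unfolding scheme_eigenspace_def column_space_eq[OF finite_carrier] scheme_projection_def
  by (simp add: mult.commute)

text \<open>For \<open>\<chi> = \<psi>\<close> the factor |G| / \<open>\<chi> \<one>\<close>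
  produced by the convolution cancels one of the two normalising factors.\<close>

lemma scheme_idempotent_mult:
  assumes "\<chi> \<in> irr_characters G" "\<psi> \<in> irr_characters G" "x \<in> carrier G" "z \<in> carrier G"
  shows "(\<Sum>y\<in>carrier G. scheme_idempotent G \<chi> x y * scheme_idempotent G \<psi> y z) =
    (if \<chi> = \<psi> then scheme_idempotent G \<psi> x z else 0)"
proof -
  let ?n = "of_nat (card (carrier G)) :: complex"
  have "(\<Sum>y\<in>carrier G. scheme_idempotent G \<chi> x y * scheme_idempotent G \<psi> y z) =
    \<chi> \<one> / ?n * (\<psi> \<one> / ?n) * (\<Sum>y\<in>carrier G. \<chi> (inv x \<otimes> y) * \<psi> (inv y \<otimes> z))"
    unfolding scheme_idempotent_def sum_distrib_left by (simp add: mult_ac)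
  then show ?thesis
    using assms irr_character_one_nonzero[OF assms(1)] card_carrier_nonzero
    by (simp add: irr_character_convolution scheme_idempotent_def)
qed

text \<open>Members of the eigenspace have the form \<open>scheme_projection \<psi> h\<close>, so
  this is the product rule for the idempotents applied to \<open>h\<close>. It lets a projection
  extract one component from a sum.\<close>

lemma scheme_projection_eigenspace:
  assumes "\<chi> \<in> irr_characters G" "\<psi> \<in> irr_characters G" "f \<in> scheme_eigenspace G \<psi>"
  shows "scheme_projection \<chi> f = (if \<chi> = \<psi> then f else (\<lambda>x\<in>carrier G. 0))"
proof -
  obtain h where h: "f = scheme_projection \<psi> h"
    using assms(3) by (auto simp: scheme_eigenspace_eq)
  have "(\<Sum>y\<in>carrier G. scheme_idempotent G \<chi> x y * f y) =
    (\<Sum>z\<in>carrier G. (if \<chi> = \<psi> then scheme_idempotent G \<psi> x z else 0) * h z)" if x: "x \<in> carrier G" for x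
  proof -
    have "(\<Sum>y\<in>carrier G. scheme_idempotent G \<chi> x y * f y) =
      (\<Sum>z\<in>carrier G. (\<Sum>y\<in>carrier G. scheme_idempotent G \<chi> x y * scheme_idempotent G \<psi> y z) * h z)"
      unfolding sum_distrib_right
      by (subst sum.swap) (simp add: h scheme_projection_def sum_distrib_left mult.assoc)
    then show ?thesis using assms(1,2) x by (simp add: scheme_idempotent_mult)
  qed
  then show ?thesis unfolding scheme_projection_def[of \<chi>]
    by (auto simp: h scheme_projection_def intro!: restrict_ext)
qed

lemma scheme_projection_sum:
  assumes "finite (irr_characters G)" "x \<in> carrier G"
  shows "(\<Sum>\<chi>\<in>irr_characters G. scheme_projection \<chi> f x) = f x"
proof -
  have "(\<Sum>\<chi>\<in>irr_characters G. scheme_projection \<chi> f x) =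
    (\<Sum>y\<in>carrier G. (\<Sum>\<chi>\<in>irr_characters G. scheme_idempotent G \<chi> x y) * f y)"
    using assms(2) unfolding sum_distrib_right by (subst sum.swap) (simp add: scheme_projection_def)
  also have "\<dots> = (\<Sum>y\<in>carrier G. if y = x then f x else 0)"
    using assms by (intro sum.cong) (auto simp: scheme_idempotent_sum)
  finally show ?thesis using assms finite_carrier by simp
qed

section \<open>Pairings with the columns of the incidence matrix\<close>

text \<open>Let \<open>h a b\<close> be the pairing of \<open>\<chi>\<close> with column
  \<open>(a, b)\<close>. The sum of all squared moduli of \<open>h a b\<close> is the Hermitian
  pairing of the convolution in \<open>orth\<close> with \<open>\<chi>\<close>, hence 0, so every
  \<open>h a b\<close> vanishes.\<close>

lemma incidence_orthogonal:
  assumes \<phi>: "group_action G \<Omega> \<phi>" and \<Omega>: "finite \<Omega>"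
    and orth: "\<And>z. z \<in> carrier G \<Longrightarrow>
      (\<Sum>y\<in>carrier G. \<chi> y * perm_character G \<Omega> \<phi> (inv y \<otimes> z)) = 0"
    and ab: "a \<in> \<Omega>" "b \<in> \<Omega>"
  shows "(\<Sum>y\<in>carrier G. \<chi> y * incidence_matrix \<phi> y (a, b)) = 0"
proof -
  interpret group_action G \<Omega> \<phi> by (rule \<phi>)
  define h where "h = (\<lambda>a b. \<Sum>y\<in>carrier G. \<chi> y * incidence_matrix \<phi> y (a, b))"
  \<comment> \<open>The permutation character gives the inner products of the rows of the incidence
    matrix: \<open>inv y \<otimes> z\<close> fixes \<open>a\<close> exactly if \<open>y\<close> and
    \<open>z\<close> send \<open>a\<close> to the same point.\<close>
  have fix_eq: "perm_character G \<Omega> \<phi> (inv y \<otimes> z) = (\<Sum>a\<in>\<Omega>. \<Sum>b\<in>\<Omega>.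
      incidence_matrix \<phi> y (a, b) * incidence_matrix \<phi> z (a, b))"
    if yz: "y \<in> carrier G" "z \<in> carrier G" for y z
  proof -
    have "(\<Sum>b\<in>\<Omega>. incidence_matrix \<phi> y (a, b) * incidence_matrix \<phi> z (a, b)) =
        (if \<phi> (inv y \<otimes> z) a = a then 1 else 0)" if a: "a \<in> \<Omega>" for a
    proof -
      have "(\<Sum>b\<in>\<Omega>. incidence_matrix \<phi> y (a, b) * incidence_matrix \<phi> z (a, b)) =
          (\<Sum>b\<in>\<Omega>. if b = \<phi> y a then (if \<phi> z a = \<phi> y a then 1 else 0) else 0)"
        by (intro sum.cong) (auto simp: incidence_matrix_def)
      also have "\<dots> = (if \<phi> z a = \<phi> y a then 1 else 0)"
        using \<Omega> element_image[OF yz(1) a] by simp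
      also have "\<phi> z a = \<phi> y a \<longleftrightarrow> \<phi> (inv y \<otimes> z) a = a"
        using a yz composition_rule[of a "inv y" z] orbit_sym_aux[of y a]
          composition_rule[of a y "inv y \<otimes> z"]
        by (metis inv_closed inv_solve_left m_closed orbit_sym_aux)
      finally show ?thesis by simp
    qed
    then show ?thesis using \<Omega> yz
      by (simp add: perm_character_def invariants_def sum.If_cases Int_def)
  qed
  \<comment> \<open>Incidence entries are 0 or 1, so conjugation only affects the values of
    \<open>\<chi>\<close>.\<close>
  have "(\<Sum>a\<in>\<Omega>. \<Sum>b\<in>\<Omega>. h a b * cnj (h a b)) = (\<Sum>a\<in>\<Omega>. \<Sum>b\<in>\<Omega>. \<Sum>z\<in>carrier G. \<Sum>y\<in>carrier G.
      cnj (\<chi> z) * \<chi> y * (incidence_matrix \<phi> y (a, b) * incidence_matrix \<phi> z (a, b)))"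
    unfolding h_def cnj_sum sum_product
    by (subst sum.swap[of _ "carrier G" "carrier G"])
      (auto intro!: sum.cong simp: incidence_matrix_def)
  also have "\<dots> = (\<Sum>z\<in>carrier G. \<Sum>y\<in>carrier G. \<Sum>a\<in>\<Omega>. \<Sum>b\<in>\<Omega>.
      cnj (\<chi> z) * \<chi> y * (incidence_matrix \<phi> y (a, b) * incidence_matrix \<phi> z (a, b)))"
    unfolding sum.swap[of _ "carrier G" \<Omega>] ..
  also have "\<dots> = (\<Sum>z\<in>carrier G. cnj (\<chi> z) *
      (\<Sum>y\<in>carrier G. \<chi> y * perm_character G \<Omega> \<phi> (inv y \<otimes> z)))"
    by (intro sum.cong) (auto simp: fix_eq sum_distrib_left mult.assoc)
  also have "\<dots> = 0" by (simp add: orth)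
  finally have "(\<Sum>a\<in>\<Omega>. \<Sum>b\<in>\<Omega>. h a b * cnj (h a b)) = 0" .
  then have "complex_of_real (\<Sum>a\<in>\<Omega>. \<Sum>b\<in>\<Omega>. (cmod (h a b))\<^sup>2) = 0"
    by (simp only: of_real_sum complex_norm_square)
  then have "(\<Sum>a\<in>\<Omega>. \<Sum>b\<in>\<Omega>. (cmod (h a b))\<^sup>2) = 0" by (simp only: of_real_eq_0_iff)
  then have "(\<Sum>b\<in>\<Omega>. (cmod (h a b))\<^sup>2) = 0"
    using \<Omega> ab by (subst (asm) sum_nonneg_eq_0_iff) (auto intro: sum_nonneg)
  then have "(cmod (h a b))\<^sup>2 = 0"
    using \<Omega> ab by (subst (asm) sum_nonneg_eq_0_iff) auto
  then show ?thesis by (simp add: h_def)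
qed

text \<open>Zero multiplicity makes the convolution with the permutation character vanish, so
  \<open>incidence_orthogonal\<close> applies to \<open>\<chi>\<close>. Its translates by group
  elements are covered too, since translation permutes the columns of the incidence matrix.\<close>

lemma scheme_projection_incidence_zero:
  assumes fin: "finite (irr_characters G)" and \<chi>: "\<chi> \<in> irr_characters G"
    and \<phi>: "group_action G \<Omega> \<phi>" and \<Omega>: "finite \<Omega>"
    and m: "\<And>g. g \<in> carrier G \<Longrightarrow>
      perm_character G \<Omega> \<phi> g = (\<Sum>\<psi>\<in>irr_characters G. of_nat (m \<psi>) * \<psi> g)"
    and m0: "m \<chi> = 0"
    and f: "f \<in> column_space (carrier G) (\<Omega> \<times> \<Omega>) (incidence_matrix \<phi>)"
  shows "scheme_projection \<chi> f = (\<lambda>x\<in>carrier G. 0)"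
proof -
  interpret group_action G \<Omega> \<phi> by (rule \<phi>)
  have "(\<Sum>y\<in>carrier G. \<chi> y * perm_character G \<Omega> \<phi> (inv y \<otimes> z)) = 0" if "z \<in> carrier G" for z
    using multiplicity_convolution[OF fin \<chi> m one_closed that] m0 by simp
  note orth = incidence_orthogonal[OF \<phi> \<Omega> this]
  have zero: "(\<Sum>y\<in>carrier G. scheme_idempotent G \<chi> x y * incidence_matrix \<phi> y (a, b)) = 0"
    if x: "x \<in> carrier G" and ab: "a \<in> \<Omega>" "b \<in> \<Omega>" for x a b
  proof -
    \<comment> \<open>Replacing \<open>y\<close> by \<open>x \<otimes> y\<close> removes
      \<open>x\<close> from the character and turns column \<open>(a, b)\<close> into column
      \<open>(a, \<phi> (inv x) b)\<close>.\<close>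
    have "(\<Sum>y\<in>carrier G. \<chi> (inv x \<otimes> y) * incidence_matrix \<phi> y (a, b)) =
      (\<Sum>y\<in>carrier G. \<chi> (inv x \<otimes> (x \<otimes> y)) * incidence_matrix \<phi> (x \<otimes> y) (a, b))"
      using sum_left_translate[OF x, of "\<lambda>y. \<chi> (inv x \<otimes> y) * incidence_matrix \<phi> y (a, b)"] by simp
    also have "\<dots> = (\<Sum>y\<in>carrier G. \<chi> y * incidence_matrix \<phi> y (a, \<phi> (inv x) b))"
    proof (intro sum.cong refl arg_cong2[of _ _ _ _ "(*)"])
      fix y assume y: "y \<in> carrier G"
      show "\<chi> (inv x \<otimes> (x \<otimes> y)) = \<chi> y" using x y by (simp add: m_assoc[symmetric])
      have "\<phi> (x \<otimes> y) a = b \<longleftrightarrow> \<phi> y a = \<phi> (inv x) b"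
        using x y ab composition_rule[of a x y] element_image[OF y, of a]
        by (metis inv_closed inv_inv orbit_sym_aux)
      then show "incidence_matrix \<phi> (x \<otimes> y) (a, b) = incidence_matrix \<phi> y (a, \<phi> (inv x) b)"
        by (simp add: incidence_matrix_def)
    qed
    also have "\<dots> = 0" using x ab by (intro orth) (auto intro: element_image)
    finally show ?thesis
      unfolding scheme_idempotent_def by (simp only: mult.assoc sum_distrib_left[symmetric] mult_zero_right)
  qed
  have fin\<Omega>: "finite (\<Omega> \<times> \<Omega>)" using \<Omega> by simp
  obtain c where c: "f = (\<lambda>x\<in>carrier G. \<Sum>p\<in>\<Omega> \<times> \<Omega>. c p * incidence_matrix \<phi> x p)"
    using f unfolding column_space_eq[OF fin\<Omega>] by auto
  have "(\<Sum>y\<in>carrier G. scheme_idempotent G \<chi> x y * f y) = 0" if x: "x \<in> carrier G" for x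
  proof -
    have "(\<Sum>y\<in>carrier G. scheme_idempotent G \<chi> x y * f y) =
      (\<Sum>p\<in>\<Omega> \<times> \<Omega>. c p * (\<Sum>y\<in>carrier G. scheme_idempotent G \<chi> x y * incidence_matrix \<phi> y p))"
      unfolding sum_distrib_left
      by (subst sum.swap) (simp add: c sum_distrib_left mult.left_commute)
    also have "\<dots> = 0" using zero[OF x] by (intro sum.neutral) auto
    finally show ?thesis .
  qed
  then show ?thesis unfolding scheme_projection_def by (intro restrict_ext) simp
qed

text \<open>A positive multiplicity makes \<open>\<chi>\<close> a nonzero multiple of its
  convolution with the permutation character. Counting fixed points in that convolution exhibits
  every column of the idempotent as a combination of incidence columns.\<close>

lemma eigenspace_subset_column_space:
  assumes fin: "finite (irr_characters G)" and \<chi>: "\<chi> \<in> irr_characters G"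
    and \<phi>: "group_action G \<Omega> \<phi>" and \<Omega>: "finite \<Omega>"
    and m: "\<And>g. g \<in> carrier G \<Longrightarrow>
      perm_character G \<Omega> \<phi> g = (\<Sum>\<psi>\<in>irr_characters G. of_nat (m \<psi>) * \<psi> g)"
    and m0: "m \<chi> > 0"
  shows "scheme_eigenspace G \<chi> \<subseteq> column_space (carrier G) (\<Omega> \<times> \<Omega>) (incidence_matrix \<phi>)"
proof
  interpret group_action G \<Omega> \<phi> by (rule \<phi>)
  have fin\<Omega>: "finite (\<Omega> \<times> \<Omega>)" using \<Omega> by simp
  fix f assume "f \<in> scheme_eigenspace G \<chi>"
  then obtain h where h: "f = scheme_projection \<chi> h" by (auto simp: scheme_eigenspace_eq)
  \<comment> \<open>The factor by which \<open>multiplicity_convolution\<close> scales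
    \<open>\<chi>\<close>; it is divided out in \<open>char\<close>.\<close>
  define q where "q = of_nat (m \<chi>) * of_nat (card (carrier G)) / \<chi> \<one>"
  have q: "q \<noteq> 0" using m0 card_carrier_nonzero irr_character_one_nonzero[OF \<chi>] by (simp add: q_def)
  have char: "\<chi> (inv x \<otimes> z) = (\<Sum>u\<in>carrier G. \<Sum>a\<in>\<Omega>.
      \<chi> u / q * incidence_matrix \<phi> x (\<phi> u a, \<phi> z a))"
    if xz: "x \<in> carrier G" "z \<in> carrier G" for x z
  proof -
    have "q * \<chi> (inv x \<otimes> z) =
        (\<Sum>y\<in>carrier G. \<chi> (inv x \<otimes> y) * perm_character G \<Omega> \<phi> (inv y \<otimes> z))"
      using multiplicity_convolution[OF fin \<chi> m, of "inv x" z] xz by (simp add: q_def)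
    \<comment> \<open>The substitution of \<open>x \<otimes> u\<close> for \<open>y\<close> moves
      \<open>x\<close> out of \<open>\<chi>\<close>. Now
      \<open>inv (x \<otimes> u) \<otimes> z\<close> fixes \<open>a\<close> exactly if
      \<open>x\<close> sends \<open>\<phi> u a\<close> to \<open>\<phi> z a\<close>, which is an
      incidence entry in row \<open>x\<close>.\<close>
    also have "\<dots> = (\<Sum>u\<in>carrier G. \<chi> (inv x \<otimes> (x \<otimes> u)) * perm_character G \<Omega> \<phi> (inv (x \<otimes> u) \<otimes> z))"
      using sum_left_translate[OF xz(1),
          of "\<lambda>y. \<chi> (inv x \<otimes> y) * perm_character G \<Omega> \<phi> (inv y \<otimes> z)"] by simp
    also have "\<dots> = (\<Sum>u\<in>carrier G. \<chi> u * (\<Sum>a\<in>\<Omega>. incidence_matrix \<phi> x (\<phi> u a, \<phi> z a)))"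
    proof (intro sum.cong refl arg_cong2[of _ _ _ _ "(*)"])
      fix u assume u: "u \<in> carrier G"
      show "\<chi> (inv x \<otimes> (x \<otimes> u)) = \<chi> u" using xz u by (simp add: m_assoc[symmetric])
      have "\<phi> (inv (x \<otimes> u) \<otimes> z) a = a \<longleftrightarrow> \<phi> x (\<phi> u a) = \<phi> z a" if a: "a \<in> \<Omega>" for a
      proof -
        have "\<phi> (inv (x \<otimes> u) \<otimes> z) a = \<phi> (inv (x \<otimes> u)) (\<phi> z a)"
          using xz u a by (intro composition_rule) auto
        moreover have "\<phi> (inv (x \<otimes> u)) (\<phi> z a) = a \<longleftrightarrow> \<phi> (x \<otimes> u) a = \<phi> z a"
          using xz u a element_image[OF xz(2) a]
          by (metis inv_closed inv_inv m_closed orbit_sym_aux)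
        moreover have "\<phi> (x \<otimes> u) a = \<phi> x (\<phi> u a)"
          using xz u a by (intro composition_rule) auto
        ultimately show ?thesis by simp
      qed
      then have "invariants \<Omega> \<phi> (inv (x \<otimes> u) \<otimes> z) = {a \<in> \<Omega>. \<phi> x (\<phi> u a) = \<phi> z a}"
        by (auto simp: invariants_def)
      then show "perm_character G \<Omega> \<phi> (inv (x \<otimes> u) \<otimes> z) =
          (\<Sum>a\<in>\<Omega>. incidence_matrix \<phi> x (\<phi> u a, \<phi> z a))"
        using xz u \<Omega> by (simp add: perm_character_def incidence_matrix_def sum.If_cases Int_def)
    qed
    finally show ?thesis using q
      by (simp add: sum_distrib_left[symmetric] sum_divide_distrib[symmetric] field_simps)
  qed
  \<comment> \<open>The sums over \<open>z\<close>, \<open>u\<close> and \<open>a\<close> are merged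
    into one index set so that \<open>column_space_sum\<close> applies; \<open>?F\<close> is the
    incidence column \<open>(\<phi> u a, \<phi> z a)\<close>.\<close>
  let ?J = "carrier G \<times> carrier G \<times> \<Omega>"
  let ?c = "\<lambda>(z, u, a). h z * (\<chi> \<one> / of_nat (card (carrier G))) * (\<chi> u / q)"
  let ?F = "\<lambda>(z, u, a) x. incidence_matrix \<phi> x (\<phi> u a, \<phi> z a)"
  have "f = (\<lambda>x\<in>carrier G. \<Sum>i\<in>?J. ?c i * ?F i x)"
    unfolding h scheme_projection_def
  proof (rule restrict_ext)
    fix x assume x: "x \<in> carrier G"
    have "(\<Sum>z\<in>carrier G. scheme_idempotent G \<chi> x z * h z) =
        (\<Sum>z\<in>carrier G. \<Sum>u\<in>carrier G. \<Sum>a\<in>\<Omega>. ?c (z, u, a) * ?F (z, u, a) x)"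
      using x by (intro sum.cong) (auto simp: scheme_idempotent_def char sum_distrib_left
          sum_distrib_right mult_ac)
    then show "(\<Sum>z\<in>carrier G. scheme_idempotent G \<chi> x z * h z) = (\<Sum>i\<in>?J. ?c i * ?F i x)"
      by (simp add: sum.cartesian_product case_prod_unfold)
  qed
  also have "\<dots> \<in> column_space (carrier G) (\<Omega> \<times> \<Omega>) (incidence_matrix \<phi>)"
    using finite_carrier \<Omega> element_image
    by (intro column_space_sum[OF fin\<Omega>]) (auto intro!: column_in_column_space)
  finally show "f \<in> column_space (carrier G) (\<Omega> \<times> \<Omega>) (incidence_matrix \<phi>)" .
qed

end

section \<open>The direct sum decomposition\<close>

theorem theorem2p4:
  fixes G :: "('g, 'm) monoid_scheme"
    and \<Omega> :: "'o set"
    and \<phi> :: "'g \<Rightarrow> 'o \<Rightarrow> 'o"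
    and \<chi> :: "nat \<Rightarrow> 'g \<Rightarrow> complex"
    and n :: nat
    and I :: "nat set"
  assumes "group_action G \<Omega> \<phi>"
    and "finite (carrier G)"
    and "finite \<Omega>"
    and "bij_betw \<chi> {0..n} (irr_characters G)"
    and "I = {k \<in> {0..n}. irr_constituent G (\<chi> k) (perm_character G \<Omega> \<phi>)}"
  shows "is_direct_sum class_ring (complex_fun_space (carrier G)) I
           (\<lambda>k. scheme_eigenspace G (\<chi> k))
           (column_space (carrier G) (\<Omega> \<times> \<Omega>) (incidence_matrix \<phi>))"
proof -
  interpret act: group_action G \<Omega> \<phi> by (rule assms(1))
  interpret finite_group G
    by (rule finite_group.intro) (use assms(2) act.group_hom in \<open>auto simp: finite_group_axioms_def group_hom_def\<close>)
  have fin: "finite (irr_characters G)" using assms(4) bij_betw_finite by blast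
  have inj: "\<chi> j = \<chi> k \<longleftrightarrow> j = k" if "j \<in> {0..n}" "k \<in> {0..n}" for j k
    using that assms(4) by (auto simp: bij_betw_def inj_on_def)
  have irr: "\<chi> k \<in> irr_characters G" if "k \<in> {0..n}" for k
    using that assms(4) by (auto simp: bij_betw_def)
  have "\<exists>\<rho>. matrix_rep G (card \<Omega>) \<rho> \<and> rep_character G (card \<Omega>) \<rho> = perm_character G \<Omega> \<phi>"
    using act.id_eq_one[symmetric]
    by (intro perm_character_is_rep_character[OF assms(3)])
      (auto intro: act.element_image simp: act.composition_rule)
  then obtain m :: "('g \<Rightarrow> complex) \<Rightarrow> nat" where m: "\<And>g. g \<in> carrier G \<Longrightarrow>
      perm_character G \<Omega> \<phi> g = (\<Sum>\<psi>\<in>irr_characters G. of_nat (m \<psi>) * \<psi> g)"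
    using rep_character_decomposition[OF fin] by metis
  \<comment> \<open>Uniqueness of multiplicities replaces the existential decomposition in
    \<open>irr_constituent\<close> by the fixed \<open>m\<close>.\<close>
  have constituent: "irr_constituent G \<psi> (perm_character G \<Omega> \<phi>) \<longleftrightarrow> m \<psi> > 0"
    if \<psi>: "\<psi> \<in> irr_characters G" for \<psi>
    using \<psi> m multiplicity_unique[OF fin \<psi>, of "perm_character G \<Omega> \<phi>" m]
    by (fastforce simp: irr_constituent_def)
  have I: "I = {k \<in> {0..n}. m (\<chi> k) > 0}" using assms(5) constituent irr by auto
  then have finI: "finite I" and In: "I \<subseteq> {0..n}" by auto
  let ?V = "\<lambda>k. scheme_eigenspace G (\<chi> k)"
  let ?W = "column_space (carrier G) (\<Omega> \<times> \<Omega>) (incidence_matrix \<phi>)"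
  let ?S = "\<lambda>u. \<Oplus>\<^bsub>complex_fun_space (carrier G)\<^esub>k\<in>I. u k"
  have ext: "f \<in> carrier G \<rightarrow>\<^sub>E UNIV" if "f \<in> scheme_eigenspace G \<psi>" for f \<psi>
    using that by (auto simp: scheme_eigenspace_eq scheme_projection_def)
  have S: "?S u = (\<lambda>x\<in>carrier G. \<Sum>k\<in>I. u k x)" if "\<And>k. k \<in> I \<Longrightarrow> u k \<in> ?V k" for u
    using that ext by (intro complex_fun_space_finsum finI) blast
  \<comment> \<open>The \<open>j\<close>-th projection recovers the \<open>j\<close>-th component of
    a sum, which makes \<open>?S\<close> injective.\<close>
  have proj: "scheme_projection (\<chi> j) (?S u) = u j"
    if u: "\<And>k. k \<in> I \<Longrightarrow> u k \<in> ?V k" and j: "j \<in> I" for u j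
  proof -
    have uk: "scheme_projection (\<chi> j) (u k) = (if k = j then u j else (\<lambda>x\<in>carrier G. 0))" if "k \<in> I" for k
      using scheme_projection_eigenspace[OF irr irr u[OF that], of j] subsetD[OF In that] subsetD[OF In j] that inj[of j k] by auto
    have "scheme_projection (\<chi> j) (?S u) = (\<lambda>x\<in>carrier G. \<Sum>k\<in>I. scheme_projection (\<chi> j) (u k) x)"
      unfolding scheme_projection_def
    proof (rule restrict_ext)
      fix x assume "x \<in> carrier G"
      have "(\<Sum>y\<in>carrier G. scheme_idempotent G (\<chi> j) x y * ?S u y) =
          (\<Sum>y\<in>carrier G. \<Sum>k\<in>I. scheme_idempotent G (\<chi> j) x y * u k y)"
        using S[of u] u by (intro sum.cong) (auto simp: sum_distrib_left)
      also have "\<dots> = (\<Sum>k\<in>I. \<Sum>y\<in>carrier G. scheme_idempotent G (\<chi> j) x y * u k y)"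
        by (rule sum.swap)
      also have "\<dots> = (\<Sum>k\<in>I. (\<lambda>x\<in>carrier G. \<Sum>y\<in>carrier G. scheme_idempotent G (\<chi> j) x y * u k y) x)"
        using \<open>x \<in> carrier G\<close> by simp
      finally show "(\<Sum>y\<in>carrier G. scheme_idempotent G (\<chi> j) x y * ?S u y) = \<dots>" .
    qed
    also have "\<dots> = (\<lambda>x\<in>carrier G. u j x)"
    proof (rule restrict_ext)
      fix x assume "x \<in> carrier G"
      then have "(\<Sum>k\<in>I. scheme_projection (\<chi> j) (u k) x) = (\<Sum>k\<in>I. if k = j then u j x else 0)"
        by (intro sum.cong) (auto simp: uk)
      then show "(\<Sum>k\<in>I. scheme_projection (\<chi> j) (u k) x) = u j x" using finI j by simp
    qed
    also have "\<dots> = u j" using ext[OF u[OF j]] by (auto simp: PiE_def extensional_restrict)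
    finally show ?thesis .
  qed
  have "bij_betw ?S (\<Pi>\<^sub>E k\<in>I. ?V k) ?W"
    unfolding bij_betw_def
  proof
    show "inj_on ?S (\<Pi>\<^sub>E k\<in>I. ?V k)"
    proof (rule inj_onI)
      fix u v assume uv: "u \<in> (\<Pi>\<^sub>E k\<in>I. ?V k)" "v \<in> (\<Pi>\<^sub>E k\<in>I. ?V k)" "?S u = ?S v"
      have "u j = v j" if "j \<in> I" for j
        using proj[of u j] proj[of v j] uv that by (auto simp: PiE_iff)
      then show "u = v" using uv by (intro PiE_ext) auto
    qed
    show "?S ` (\<Pi>\<^sub>E k\<in>I. ?V k) = ?W"
    proof
      show "?S ` (\<Pi>\<^sub>E k\<in>I. ?V k) \<subseteq> ?W"
      proof clarify
        fix u assume "u \<in> (\<Pi>\<^sub>E k\<in>I. ?V k)"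
        then have u: "\<And>k. k \<in> I \<Longrightarrow> u k \<in> ?V k" by auto
        have "(\<lambda>x\<in>carrier G. u k x) \<in> ?W" if k: "k \<in> I" for k
        proof -
          have "u k \<in> ?W"
            using eigenspace_subset_column_space[OF fin irr assms(1,3) m, of k] u k I by auto
          moreover have "(\<lambda>x\<in>carrier G. u k x) = u k"
            using ext[OF u[OF k]] by (auto simp: PiE_def extensional_restrict)
          ultimately show ?thesis by simp
        qed
        then have "(\<lambda>x\<in>carrier G. \<Sum>k\<in>I. 1 * u k x) \<in> ?W"
          using finI assms(3) by (intro column_space_sum) auto
        then show "?S u \<in> ?W" by (simp only: S[of u, OF u] mult_1)
      qed
      show "?W \<subseteq> ?S ` (\<Pi>\<^sub>E k\<in>I. ?V k)"
      proof
        fix f assume f: "f \<in> ?W"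
        \<comment> \<open>The preimage of \<open>f\<close> is the family of its projections with
          index in \<open>I\<close>.\<close>
        let ?u = "\<lambda>k\<in>I. scheme_projection (\<chi> k) f"
        have u: "\<And>k. k \<in> I \<Longrightarrow> ?u k \<in> ?V k" by (auto simp: scheme_eigenspace_eq)
        \<comment> \<open>The projections are summed only at points of the group; extensionality
          turns agreement there into equality of functions.\<close>
        have fext: "f \<in> extensional (carrier G)"
          using f column_space_eq[of "\<Omega> \<times> \<Omega>" "carrier G" "incidence_matrix \<phi>"] assms(3) by auto
        have "(\<lambda>x\<in>carrier G. \<Sum>k\<in>I. ?u k x) = (\<lambda>x\<in>carrier G. f x)"
        proof (rule restrict_ext)
          fix x assume x: "x \<in> carrier G"
          \<comment> \<open>Indices outside \<open>I\<close> have multiplicity 0, so their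
            projections kill \<open>f\<close> and the sum may run over all irreducible
            characters.\<close>
          have "(\<Sum>k\<in>I. ?u k x) = (\<Sum>k\<in>{0..n}. scheme_projection (\<chi> k) f x)"
            using x I scheme_projection_incidence_zero[OF fin irr assms(1,3) m _ f]
            by (intro sum.mono_neutral_cong_left) auto
          also have "\<dots> = (\<Sum>\<psi>\<in>irr_characters G. scheme_projection \<psi> f x)"
            by (rule sum.reindex_bij_betw[OF assms(4)])
          also have "\<dots> = f x" by (rule scheme_projection_sum[OF fin x])
          finally show "(\<Sum>k\<in>I. ?u k x) = f x" .
        qed
        then have "?S ?u = f" using fext S[of ?u, OF u] by (simp only: extensional_restrict)
        moreover have "?u \<in> (\<Pi>\<^sub>E k\<in>I. ?V k)" using u by auto
        ultimately show "f \<in> ?S ` (\<Pi>\<^sub>E k\<in>I. ?V k)" by (intro image_eqI[of _ _ ?u]) auto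
      qed
    qed
  qed
  then show ?thesis
    unfolding is_direct_sum_def
    using finI column_space_subspace by (auto simp: scheme_eigenspace_def)
qed

end
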